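(* Let $V\subset\mathbb{R}^2$ be a bounded neighbourhood of the origin and let $f\in C^{8}(\overline V)$ be a real-valued function of the form $$f(x_1,x_2)=x_1x_2^2+g(x_1,x_2),$$ where $g\in C^{8}(\overline V)$ satisfies $D^{\alpha}g(0,0)=0$ for all multi-indices $\alpha=(\alpha_1,\alpha_2)\in\mathbb{Z}_+^2$ with $\alpha_1+\alpha_2\le 3$. Then there exist positive numbers $\varepsilon, C$ and a neighbourhood $U\subset V$ of the origin such that for every $a\in C_0^1(U)$, every real-valued $F\in C^{8}(\overline V)$ with $\|F\|_{C^{8}(\overline V)}<\varepsilon$, and every real $\lambda\neq 0$, $$\left|\int_U e^{i\lambda (f(x)+F(x))}a(x)\,dx\right|\le \frac{C\,\|a\|_{C^1}}{|\lambda|^{1/2}}.$$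
   Context: $D^\alpha=\dfrac{\partial^{|\alpha|}}{\partial x_1^{\alpha_1}\partial x_2^{\alpha_2}}$ with $|\alpha|=\alpha_1+\alpha_2$, and $\mathbb{Z}_+=\{0\}\cup\mathbb{N}$. $\overline V$ is the closure of $V$. For $N\in\mathbb{N}$, $$\|F\|_{C^{N}(\overline V)}=\max_{x\in\overline V}\sum_{|\alpha|\le N}|D^\alpha F(x)|.$$ $C_0^1(U)$ is the space of $C^1$ functions with compact support contained in $U$, and $\|a\|_{C^1}$ is the $C^1$ norm, $\|a\|_{C^1}=\max\sum_{|\alpha|\le 1}|D^\alpha a|$. *)

theory Defs
  imports "HOL-Analysis.Analysis"
begin

definition partial_deriv :: "2 \<Rightarrow> (real^2 \<Rightarrow> 'b::real_normed_vector) \<Rightarrow> real^2 \<Rightarrow> 'b" where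
  "partial_deriv i f x = vector_derivative (\<lambda>t. f (x + t *\<^sub>R axis i 1)) (at 0)"

definition has_partial_deriv_at :: "2 \<Rightarrow> (real^2 \<Rightarrow> 'b::real_normed_vector) \<Rightarrow> real^2 \<Rightarrow> bool" where
  "has_partial_deriv_at i f x \<longleftrightarrow> (\<lambda>t. f (x + t *\<^sub>R axis i 1)) differentiable (at 0)"

definition D :: "nat \<times> nat \<Rightarrow> (real^2 \<Rightarrow> 'b::real_normed_vector) \<Rightarrow> real^2 \<Rightarrow> 'b" where
  "D \<alpha> f = (partial_deriv 1 ^^ fst \<alpha>) ((partial_deriv 2 ^^ snd \<alpha>) f)"

definition multi_indices :: "nat \<Rightarrow> (nat \<times> nat) set" where
  "multi_indices N = {\<alpha>. fst \<alpha> + snd \<alpha> \<le> N}"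

(* C^N(V), intended for open V. *)
primrec C_open :: "nat \<Rightarrow> (real^2) set \<Rightarrow> (real^2 \<Rightarrow> 'b::real_normed_vector) \<Rightarrow> bool" where
  "C_open 0 V f \<longleftrightarrow> continuous_on V f"
| "C_open (Suc N) V f \<longleftrightarrow> continuous_on V f \<and>
     (\<forall>i. (\<forall>x\<in>V. has_partial_deriv_at i f x) \<and> C_open N V (partial_deriv i f))"

(* C^N of the closure of an open set V: all derivatives of order at most N extend
   continuously from V to the closure, and f agrees there with its own extension; values of f
   off the closure are irrelevant. *)
definition C_closure :: "nat \<Rightarrow> (real^2) set \<Rightarrow> (real^2 \<Rightarrow> 'b::real_normed_vector) \<Rightarrow> bool" where
  "C_closure N V f \<longleftrightarrow> C_open N V f \<and> continuous_on (closure V) f \<and>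
     (\<forall>\<alpha>\<in>multi_indices N. \<exists>G. continuous_on (closure V) G \<and> (\<forall>x\<in>V. G x = D \<alpha> f x))"

(* The value at a point of the closure of V of the continuous extension of the derivative;
   inside an open V it is the derivative itself whenever that is continuous. *)
definition D_closure :: "(real^2) set \<Rightarrow> nat \<times> nat \<Rightarrow> (real^2 \<Rightarrow> 'b::real_normed_vector) \<Rightarrow> real^2 \<Rightarrow> 'b" where
  "D_closure V \<alpha> f x = Lim (at x within V) (D \<alpha> f)"

(* For bounded V and f in C^N of the closure the supremum is attained. *)
definition C_norm :: "nat \<Rightarrow> (real^2) set \<Rightarrow> (real^2 \<Rightarrow> 'b::real_normed_vector) \<Rightarrow> real" where
  "C_norm N V f = (SUP x\<in>closure V. \<Sum>\<alpha>\<in>multi_indices N. norm (D_closure V \<alpha> f x))"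

(* Functions compactly supported in U are taken to be extended by 0 to the plane. *)
definition C1_compact_support :: "(real^2) set \<Rightarrow> (real^2 \<Rightarrow> 'b::real_normed_vector) set" where
  "C1_compact_support U = {a. C_open 1 UNIV a \<and> compact (closure {x. a x \<noteq> 0}) \<and> closure {x. a x \<noteq> 0} \<subseteq> U}"

lemma D_closure_eq_extension:
  assumes "open V"
    and G: "continuous_on (closure V) G" "\<forall>x\<in>V. G x = D \<alpha> f x"
    and x: "x \<in> closure V"
  shows "D_closure V \<alpha> f x = G x"
proof -
  have ne: "at x within V \<noteq> bot"
  proof (cases "x \<in> V")
    case True
    then have "at x within V = at x" using assms(1) by (rule at_within_open)
    then show ?thesis using at_neq_bot by metis
  next
    case False
    with x have "x islimpt V" unfolding closure_def by blast
    then show ?thesis by (simp only: trivial_limit_within not_not)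
  qed
  have "(G \<longlongrightarrow> G x) (at x within closure V)" using G(1) x by (simp only: continuous_on_def)
  then have "(G \<longlongrightarrow> G x) (at x within V)" using closure_subset by (rule tendsto_within_subset)
  moreover have "\<forall>\<^sub>F y in at x within V. G y = D \<alpha> f y"
    using G(2) unfolding eventually_at_filter by (intro always_eventually) blast
  ultimately have "(D \<alpha> f \<longlongrightarrow> G x) (at x within V)"
    by (rule Lim_transform_eventually)
  with ne show ?thesis unfolding D_closure_def by (rule tendsto_Lim)
qed

lemma finite_multi_indices: "finite (multi_indices N)"
  by (rule finite_subset[of _ "{..N} \<times> {..N}"]) (auto simp: multi_indices_def)

end

theory Submission
  imports Defs
begin

text \<open>On a small ball the Hessian of the phase \<open>\<phi> = f + F\<close> is, up to its constant upper left entry and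
  a small Lipschitz error, that of \<open>x\<^sub>1 x\<^sub>2\<^sup>2\<close>. Hence there is a point \<open>p\<close> at which the entries
  \<open>\<phi>\<^sub>1\<^sub>2\<close> and \<open>\<phi>\<^sub>2\<^sub>2\<close> vanish, and with \<open>y = x - p\<close> they are close to
  \<open>2 y\<^sub>2\<close> and \<open>2 y\<^sub>1\<close>. The lines \<open>y\<^sub>2 = y\<^sub>1\<close> and \<open>y\<^sub>2 = - y\<^sub>1\<close> cut the ball into
  four convex sectors. On each of them one of the directions \<open>(0, 1)\<close>, \<open>(1, 1)\<close>, \<open>(1, -1)\<close> has a second
  derivative of constant sign whose modulus is at least half the modulus of a coordinate \<open>u\<close> transversal to that
  direction. Van der Corput's lemma bounds the integral over each line by a multiple of
  \<open>(\<bar>\<lambda>\<bar> \<bar>u\<bar>)\<^sup>-\<^sup>1\<^sup>/\<^sup>2\<close>, and \<open>\<bar>u\<bar>\<^sup>-\<^sup>1\<^sup>/\<^sup>2\<close> is integrable.\<close>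

section \<open>Van der Corput bounds\<close>

text \<open>No single direction serves: \<open>\<phi>22\<close> behaves like 2 y_1 and vanishes near
  the line y_1 = 0, where only the mixed entry, of size about 2 |y_2|, is available. That entry
  becomes visible in a diagonal direction, whose second derivative is \<open>\<phi>11\<close> + 2
  \<open>\<phi>12\<close> + \<open>\<phi>22\<close> or \<open>\<phi>11\<close> - 2
  \<open>\<phi>12\<close> + \<open>\<phi>22\<close>. There \<open>\<phi>11\<close> contributes a
  constant of unknown sign which need not be small compared with |y|, so the choice between the two
  diagonals depends on the sign of \<open>\<phi>11 p\<close>. Uniformity in \<open>F\<close> is the
  reason for recentring at \<open>p\<close>: a perturbation moves the point where the two entries
  vanish, and about the origin they would contain constants that |y| does not control. About
  \<open>p\<close> every error is Lipschitz, hence a multiple of |y|. The exponent 1/2 is already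
  that of x_1 x_2^2 itself: on vertical lines its second derivative is 2 x_1, and its oscillatory
  integral is in general of exact order |l|^(-1/2).\<close>

lemma oscillatory_integral_first_derivative:
  fixes \<phi> \<phi>' \<phi>'' :: "real \<Rightarrow> real"
  assumes "a \<le> b" and "\<mu> > 0"
    and d1: "\<And>t. t \<in> {a..b} \<Longrightarrow> (\<phi> has_real_derivative \<phi>' t) (at t within {a..b})"
    and d2: "\<And>t. t \<in> {a..b} \<Longrightarrow> (\<phi>' has_real_derivative \<phi>'' t) (at t within {a..b})"
    and pos: "\<And>t. t \<in> {a..b} \<Longrightarrow> \<phi>'' t \<ge> 0"
    and lb: "\<And>t. t \<in> {a..b} \<Longrightarrow> \<mu> \<le> \<bar>\<phi>' t\<bar>"
  shows "norm (integral {a..b} (\<lambda>t. exp (\<i> * of_real (\<phi> t)))) \<le> 4 / \<mu>"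
proof -
  have nz: "\<phi>' t \<noteq> 0" if "t \<in> {a..b}" for t using lb[OF that] \<open>\<mu> > 0\<close> by auto
  define E where "E = (\<lambda>t. exp (\<i> * complex_of_real (\<phi> t)))"
  define G where "G = (\<lambda>t. E t * of_real (1 / \<phi>' t))"
  \<comment> \<open>\<open>q\<close> is minus the derivative of 1 / \<open>\<phi>'\<close>. It is
    nonnegative because \<open>\<phi>'\<close> is monotone, so the integral of |q| is a difference
    of boundary values and no bound on \<open>\<phi>''\<close> is required.\<close>
  define q where "q = (\<lambda>t. \<phi>'' t / (\<phi>' t)\<^sup>2)"
  have nE: "norm (E t) = 1" for t unfolding E_def by simp
  have dE: "(E has_vector_derivative \<i> * of_real (\<phi>' t) * E t) (at t within {a..b})" if "t \<in> {a..b}" for t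
  proof -
    have "((\<lambda>t. complex_of_real (\<phi> t)) has_vector_derivative of_real (\<phi>' t)) (at t within {a..b})"
      using d1[OF that] has_vector_derivative_of_real by blast
    then have "((\<lambda>t. \<i> * complex_of_real (\<phi> t)) has_vector_derivative \<i> * of_real (\<phi>' t)) (at t within {a..b})"
      by (rule has_vector_derivative_mult_right)
    from field_vector_diff_chain_within[OF this DERIV_subset[OF DERIV_exp]]
    show ?thesis unfolding E_def o_def by simp
  qed
  have dinv: "((\<lambda>t. 1 / \<phi>' t) has_real_derivative - q t) (at t within {a..b})" if "t \<in> {a..b}" for t
    unfolding q_def using d2[OF that] nz[OF that]
    by (auto intro!: derivative_eq_intros simp: power2_eq_square)
  have dG: "(G has_vector_derivative (\<i> * E t - E t * of_real (q t))) (at t within {a..b})" if "t \<in> {a..b}" for t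
  proof -
    have "((\<lambda>t. complex_of_real (1 / \<phi>' t)) has_vector_derivative of_real (- q t)) (at t within {a..b})"
      using dinv[OF that] has_vector_derivative_of_real by blast
    from has_vector_derivative_mult[OF dE[OF that] this]
    show ?thesis unfolding G_def using nz[OF that] by (simp add: algebra_simps)
  qed
  have cE: "continuous_on {a..b} E"
    by (rule continuous_on_vector_derivative[OF dE])
  then have iE: "(E has_integral integral {a..b} E) {a..b}"
    using integrable_continuous_real integrable_integral by blast
  have "((\<lambda>t. \<i> * E t - E t * of_real (q t)) has_integral (G b - G a)) {a..b}"
    using fundamental_theorem_of_calculus[OF \<open>a \<le> b\<close> dG] by blast
  from has_integral_diff[OF has_integral_mult_right[OF iE, of \<i>] this]
  have i2: "((\<lambda>t. E t * of_real (q t)) has_integral (\<i> * integral {a..b} E - (G b - G a))) {a..b}"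
    by simp
  have "((\<lambda>t. - q t) has_integral (1 / \<phi>' b - 1 / \<phi>' a)) {a..b}"
    by (rule fundamental_theorem_of_calculus[OF \<open>a \<le> b\<close>])
       (use dinv has_real_derivative_iff_has_vector_derivative in blast)
  from has_integral_neg[OF this] have i3: "(q has_integral (1 / \<phi>' a - 1 / \<phi>' b)) {a..b}"
    by (simp add: algebra_simps)
  have q0: "q t \<ge> 0" if "t \<in> {a..b}" for t using pos[OF that] unfolding q_def by simp
  have "norm (\<i> * integral {a..b} E - (G b - G a)) \<le> 1 / \<phi>' a - 1 / \<phi>' b"
    using integral_norm_bound_integral[OF has_integral_integrable[OF i2] has_integral_integrable[OF i3]]
      integral_unique[OF i2] integral_unique[OF i3] q0 by (simp add: norm_mult nE)
  moreover have bd: "\<bar>1 / \<phi>' t\<bar> \<le> 1 / \<mu>" if "t \<in> {a..b}" for t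
    using lb[OF that] \<open>\<mu> > 0\<close> nz[OF that] by (simp add: field_simps)
  moreover have "norm (G t) \<le> 1 / \<mu>" if "t \<in> {a..b}" for t
    unfolding G_def norm_mult nE norm_of_real using bd[OF that] by simp
  moreover have "1 / \<phi>' a - 1 / \<phi>' b \<le> 2 / \<mu>"
    using bd[of a] bd[of b] \<open>a \<le> b\<close> unfolding abs_le_iff by auto
  ultimately have *: "norm (\<i> * integral {a..b} E - (G b - G a)) \<le> 2 / \<mu>" "norm (G a) \<le> 1 / \<mu>" "norm (G b) \<le> 1 / \<mu>"
    using \<open>a \<le> b\<close> by auto
  \<comment> \<open>The integral of \<open>q\<close> contributes 2 / \<open>\<mu>\<close>, and each
    of the two boundary values of \<open>G\<close> contributes 1 / \<open>\<mu>\<close>.\<close>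
  have "norm (integral {a..b} E) = norm (\<i> * integral {a..b} E)" by (simp add: norm_mult)
  also have "\<dots> \<le> norm (\<i> * integral {a..b} E - (G b - G a)) + (norm (G b) + norm (G a))"
    using norm_triangle_ineq[of "\<i> * integral {a..b} E - (G b - G a)" "G b - G a"] norm_triangle_ineq4[of "G b" "G a"]
    by simp
  also have "\<dots> \<le> 4 / \<mu>" using * by simp
  finally show ?thesis unfolding E_def .
qed

text \<open>Around the point \<open>c\<close> where |\<open>\<phi>'\<close>| is least a window of
  radius \<open>h\<close> is estimated trivially by 2 \<open>h\<close>. Outside it
  |\<open>\<phi>'\<close>| is at least \<open>m * h\<close>, so each side contributes at most 4 /
  (\<open>m * h\<close>). The choice \<open>h\<close> = 1 / sqrt \<open>m\<close> makes all three
  terms multiples of \<open>h\<close>, with sum 10 \<open>h\<close>.\<close>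

lemma van_der_Corput_convex:
  fixes \<phi> \<phi>' \<phi>'' :: "real \<Rightarrow> real"
  assumes "a \<le> b" and "m > 0"
    and d1: "\<And>t. t \<in> {a..b} \<Longrightarrow> (\<phi> has_real_derivative \<phi>' t) (at t within {a..b})"
    and d2: "\<And>t. t \<in> {a..b} \<Longrightarrow> (\<phi>' has_real_derivative \<phi>'' t) (at t within {a..b})"
    and lb: "\<And>t. t \<in> {a..b} \<Longrightarrow> m \<le> \<phi>'' t"
  shows "norm (integral {a..b} (\<lambda>t. exp (\<i> * of_real (\<phi> t)))) \<le> 10 / sqrt m"
proof -
  define E where "E = (\<lambda>t. exp (\<i> * complex_of_real (\<phi> t)))"
  define h where "h = 1 / sqrt m"
  have h: "h > 0" "m * h = sqrt m" using \<open>m > 0\<close> by (simp_all add: h_def real_div_sqrt)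
  have grow: "\<phi>' t - \<phi>' s \<ge> m * (t - s)" if "a \<le> s" "s \<le> t" "t \<le> b" for s t
  proof (cases "s = t")
    case False
    with that have "s < t" by simp
    have "\<exists>x\<in>{s<..<t}. \<phi>' t - \<phi>' s = (t - s) * \<phi>'' x"
    proof (rule mvt_simple[OF \<open>s < t\<close>, of \<phi>' "\<lambda>x y. y * \<phi>'' x", simplified])
      fix x assume "s \<le> x" "x \<le> t"
      with that have x: "x \<in> {a..b}" by simp
      have "(\<phi>' has_real_derivative \<phi>'' x) (at x within {s..t})"
        by (rule DERIV_subset[OF d2[OF x]]) (use that in auto)
      then show "(\<phi>' has_derivative (\<lambda>y. y * \<phi>'' x)) (at x within {s..t})"
        by (simp add: has_field_derivative_def mult_commute_abs)
    qed
    then obtain x where "x \<in> {s<..<t}" "\<phi>' t - \<phi>' s = (t - s) * \<phi>'' x" by blast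
    moreover have "m \<le> \<phi>'' x" using lb[of x] that \<open>x \<in> _\<close> by auto
    ultimately show ?thesis using \<open>s < t\<close> by (simp add: mult.commute mult_left_mono)
  qed simp
  have cphi': "continuous_on {a..b} \<phi>'"
    by (rule DERIV_continuous_on[OF d2])
  \<comment> \<open>\<open>c\<close> is a zero of \<open>\<phi>'\<close>, or the end of the interval
    where |\<open>\<phi>'\<close>| is least if the sign of \<open>\<phi>'\<close> does not change;
    at an end one of the two growth claims is vacuous.\<close>
  obtain c where c: "a \<le> c" "c \<le> b" "\<And>t. c < t \<Longrightarrow> t \<le> b \<Longrightarrow> \<phi>' t \<ge> m * (t - c)"
    "\<And>t. a \<le> t \<Longrightarrow> t < c \<Longrightarrow> \<phi>' t \<le> - (m * (c - t))"
  proof -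
    consider "\<phi>' a \<ge> 0" | "\<phi>' b \<le> 0" | "\<phi>' a \<le> 0" "0 \<le> \<phi>' b" by linarith
    then show ?thesis
    proof cases
      case 1
      show ?thesis
      proof (rule that[of a])
        fix t assume "a < t" "t \<le> b"
        then show "m * (t - a) \<le> \<phi>' t" using grow[of a t] 1 by simp
      qed (use \<open>a \<le> b\<close> in auto)
    next
      case 2
      show ?thesis
      proof (rule that[of b])
        fix t assume "a \<le> t" "t < b"
        then show "\<phi>' t \<le> - (m * (b - t))" using grow[of t b] 2 by simp
      qed (use \<open>a \<le> b\<close> in auto)
    next
      case 3
      from IVT'[OF 3 \<open>a \<le> b\<close> cphi'] obtain c where c: "a \<le> c" "c \<le> b" "\<phi>' c = 0" by blast
      show ?thesis
      proof (rule that[OF c(1,2)])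
        fix t assume "c < t" "t \<le> b"
        then show "m * (t - c) \<le> \<phi>' t" using grow[of c t] c by simp
      next
        fix t assume "a \<le> t" "t < c"
        then show "\<phi>' t \<le> - (m * (c - t))" using grow[of t c] c by simp
      qed
    qed
  qed
  have cE: "continuous_on {a..b} E"
    unfolding E_def by (intro continuous_intros DERIV_continuous_on[OF d1])
  have far: "norm (integral {s..t} E) \<le> 4 * h"
    if "a \<le> s" "t \<le> b" "\<And>x. x \<in> {s..t} \<Longrightarrow> sqrt m \<le> \<bar>\<phi>' x\<bar>" for s t
  proof (cases "s \<le> t")
    case True
    have "norm (integral {s..t} E) \<le> 4 / sqrt m"
      unfolding E_def
    proof (rule oscillatory_integral_first_derivative[OF True, where \<phi>' = \<phi>' and \<phi>'' = \<phi>''])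
      fix x assume x: "x \<in> {s..t}"
      then have x': "x \<in> {a..b}" and sub: "{s..t} \<subseteq> {a..b}" using that by auto
      show "(\<phi> has_real_derivative \<phi>' x) (at x within {s..t})" "(\<phi>' has_real_derivative \<phi>'' x) (at x within {s..t})"
        using DERIV_subset[OF d1[OF x'] sub] DERIV_subset[OF d2[OF x'] sub] by auto
      show "\<phi>'' x \<ge> 0" using lb[OF x'] \<open>m > 0\<close> by simp
      show "sqrt m \<le> \<bar>\<phi>' x\<bar>" using that x by blast
    qed (use \<open>m > 0\<close> in simp)
    then show ?thesis by (simp add: h_def)
  qed (use h in simp)
  define l where "l = max a (c - h)"
  define r where "r = min b (c + h)"
  have lr: "a \<le> l" "l \<le> c" "c \<le> r" "r \<le> b" using c h unfolding l_def r_def by auto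
  have left: "norm (integral {a..l} E) \<le> 4 * h"
  proof (cases "l = a")
    case False
    then have l: "l = c - h" unfolding l_def by auto
    show ?thesis
    proof (rule far)
      fix x assume x: "x \<in> {a..l}"
      then have "m * h \<le> m * (c - x)" using l \<open>m > 0\<close> by (intro mult_left_mono) auto
      then show "sqrt m \<le> \<bar>\<phi>' x\<bar>" using c(4)[of x] x lr h l by auto
    qed (use lr in auto)
  qed (use h in simp)
  have right: "norm (integral {r..b} E) \<le> 4 * h"
  proof (cases "r = b")
    case False
    then have r: "r = c + h" unfolding r_def by auto
    show ?thesis
    proof (rule far)
      fix x assume x: "x \<in> {r..b}"
      then have "m * h \<le> m * (x - c)" using r \<open>m > 0\<close> by (intro mult_left_mono) auto
      then show "sqrt m \<le> \<bar>\<phi>' x\<bar>" using c(3)[of x] x lr h r by auto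
    qed (use lr in auto)
  qed (use h in simp)
  have mid: "norm (integral {l..r} E) \<le> 1 * (r - l)"
    using lr by (intro integral_bound continuous_on_subset[OF cE]) (auto simp: E_def)
  have int: "E integrable_on {a..b}" by (rule integrable_continuous_real[OF cE])
  have "integral {a..b} E = integral {a..l} E + integral {l..r} E + integral {r..b} E"
    using Henstock_Kurzweil_Integration.integral_combine[of a l b E] Henstock_Kurzweil_Integration.integral_combine[of l r b E] lr int
      integrable_subinterval_real[OF int, of l b] by (simp add: add.assoc)
  then have "norm (integral {a..b} E) \<le> norm (integral {a..l} E) + norm (integral {l..r} E) + norm (integral {r..b} E)"
    using norm_triangle_ineq[of "integral {a..l} E + integral {l..r} E" "integral {r..b} E"]
      norm_triangle_ineq[of "integral {a..l} E" "integral {l..r} E"] by simp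
  also have "\<dots> \<le> 10 * h"
  proof -
    have "r - l \<le> 2 * h" unfolding l_def r_def by (auto simp: max_def min_def)
    with left right mid show ?thesis by simp
  qed
  finally show ?thesis by (simp add: h_def E_def)
qed

text \<open>The sign -1 reduces to the convex case by conjugating the integrand, which preserves the
  modulus of the integral.\<close>

lemma van_der_Corput:
  fixes \<phi> \<phi>' \<phi>'' :: "real \<Rightarrow> real"
  assumes "a \<le> b" and "m > 0" and s: "s = 1 \<or> s = -1"
    and d1: "\<And>t. t \<in> {a..b} \<Longrightarrow> (\<phi> has_real_derivative \<phi>' t) (at t within {a..b})"
    and d2: "\<And>t. t \<in> {a..b} \<Longrightarrow> (\<phi>' has_real_derivative \<phi>'' t) (at t within {a..b})"
    and lb: "\<And>t. t \<in> {a..b} \<Longrightarrow> m \<le> s * \<phi>'' t"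
  shows "norm (integral {a..b} (\<lambda>t. exp (\<i> * of_real (\<phi> t)))) \<le> 10 / sqrt m"
proof -
  have "norm (integral {a..b} (\<lambda>t. exp (\<i> * of_real (s * \<phi> t)))) \<le> 10 / sqrt m"
    by (rule van_der_Corput_convex[of a b m _ "\<lambda>t. s * \<phi>' t" "\<lambda>t. s * \<phi>'' t"])
       (use assms in \<open>auto intro!: DERIV_cmult\<close>)
  moreover have "norm (integral {a..b} (\<lambda>t. exp (\<i> * of_real (- \<phi> t)))) = norm (integral {a..b} (\<lambda>t. exp (\<i> * of_real (\<phi> t))))"
  proof -
    have "(\<lambda>t. exp (\<i> * complex_of_real (- \<phi> t))) = (\<lambda>t. cnj (exp (\<i> * of_real (\<phi> t))))"
      by (simp add: exp_cnj)
    then show ?thesis by (metis complex_mod_cnj integral_cnj)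
  qed
  ultimately show ?thesis using s by auto
qed

text \<open>Integration by parts against the primitive \<open>P\<close> of the oscillating factor.
  Van der Corput bounds the integral over every initial segment by the same constant whatever its
  length, so |P| stays below \<open>M\<close>; since \<open>P a\<close> = 0, only the boundary term
  at \<open>b\<close> survives.\<close>

lemma van_der_Corput_amplitude:
  fixes \<phi> \<phi>' \<phi>'' :: "real \<Rightarrow> real" and w w' :: "real \<Rightarrow> complex"
  assumes "a \<le> b" and "m > 0" and s: "s = 1 \<or> s = -1"
    and d1: "\<And>t. t \<in> {a..b} \<Longrightarrow> (\<phi> has_real_derivative \<phi>' t) (at t within {a..b})"
    and d2: "\<And>t. t \<in> {a..b} \<Longrightarrow> (\<phi>' has_real_derivative \<phi>'' t) (at t within {a..b})"
    and lb: "\<And>t. t \<in> {a..b} \<Longrightarrow> m \<le> s * \<phi>'' t"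
    and dw: "\<And>t. t \<in> {a..b} \<Longrightarrow> (w has_vector_derivative w' t) (at t within {a..b})"
    and "norm (w b) \<le> N" and w': "\<And>t. t \<in> {a..b} \<Longrightarrow> norm (w' t) \<le> N'"
  shows "norm (integral {a..b} (\<lambda>t. exp (\<i> * of_real (\<phi> t)) * w t)) \<le> 10 / sqrt m * (N + N' * (b - a))"
proof -
  define E where "E = (\<lambda>t. exp (\<i> * complex_of_real (\<phi> t)))"
  define P where "P = (\<lambda>t. integral {a..t} E)"
  define M where "M = 10 / sqrt m"
  have M: "M \<ge> 0" using \<open>m > 0\<close> by (simp add: M_def)
  have cE: "continuous_on {a..b} E"
    unfolding E_def by (intro continuous_intros DERIV_continuous_on[OF d1])
  have nP: "norm (P t) \<le> M" if "t \<in> {a..b}" for t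
  proof -
    have sub: "{a..t} \<subseteq> {a..b}" using that by auto
    show ?thesis unfolding P_def E_def M_def
      by (rule van_der_Corput[of a t m s \<phi> \<phi>' \<phi>''])
         (use that assms in \<open>auto intro!: DERIV_subset[OF d1 sub] DERIV_subset[OF d2 sub]\<close>)
  qed
  have dP: "(P has_vector_derivative E t) (at t within {a..b})" if "t \<in> {a..b}" for t
    unfolding P_def by (rule integral_has_vector_derivative[OF cE that])
  have "((\<lambda>t. P t * w' t + E t * w t) has_integral (P b * w b - P a * w a)) {a..b}"
    by (rule fundamental_theorem_of_calculus[OF \<open>a \<le> b\<close>])
       (use has_vector_derivative_mult[OF dP dw] in auto)
  then have i1: "((\<lambda>t. P t * w' t + E t * w t) has_integral (P b * w b)) {a..b}" by (simp add: P_def)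
  have "continuous_on {a..b} w"
    by (rule continuous_on_vector_derivative[OF dw])
  then have iE: "((\<lambda>t. E t * w t) has_integral integral {a..b} (\<lambda>t. E t * w t)) {a..b}"
    by (intro integrable_integral integrable_continuous_real continuous_intros cE)
  from has_integral_diff[OF i1 iE]
  have i2: "((\<lambda>t. P t * w' t) has_integral (P b * w b - integral {a..b} (\<lambda>t. E t * w t))) {a..b}" by simp
  have "norm (integral {a..b} (\<lambda>t. P t * w' t)) \<le> integral {a..b} (\<lambda>t. M * N')"
  proof (rule integral_norm_bound_integral[OF has_integral_integrable[OF i2]])
    fix t assume "t \<in> {a..b}"
    then show "norm (P t * w' t) \<le> M * N'"
      unfolding norm_mult by (intro mult_mono nP w' M) auto
  qed (rule integrable_const_ivl)
  then have "norm (P b * w b - integral {a..b} (\<lambda>t. E t * w t)) \<le> M * N' * (b - a)"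
    using integral_unique[OF i2] \<open>a \<le> b\<close> by (simp add: mult_ac)
  moreover have "norm (P b * w b) \<le> M * N"
    unfolding norm_mult using nP[of b] \<open>a \<le> b\<close> assms(8) M by (intro mult_mono) auto
  ultimately have "norm (integral {a..b} (\<lambda>t. E t * w t)) \<le> M * N + M * N' * (b - a)"
    using norm_triangle_ineq4[of "P b * w b" "P b * w b - integral {a..b} (\<lambda>t. E t * w t)"] by simp
  then show ?thesis unfolding M_def E_def by (simp only: distrib_left mult.assoc)
qed

section \<open>Integration along parallel lines\<close>

lemma distr_lborel_axes:
  "distr (lborel \<Otimes>\<^sub>M lborel) borel (\<lambda>(s, t). s *\<^sub>R axis 1 1 + t *\<^sub>R axis 2 1 :: real^2) = lborel"
proof (rule lborel_eqI[symmetric])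
  let ?Q = "\<lambda>(s, t). s *\<^sub>R axis 1 1 + t *\<^sub>R axis 2 1 :: real^2"
  have B: "(Basis :: (real^2) set) = {axis 1 1, axis 2 1}" by (auto simp: Basis_vec_def UNIV_2)
  have ne: "axis 1 1 \<noteq> (axis 2 1 :: real^2)" by (simp add: axis_eq_axis)
  fix l u :: "real^2" assume le: "\<And>b. b \<in> Basis \<Longrightarrow> l \<bullet> b \<le> u \<bullet> b"
  have "?Q \<in> (lborel \<Otimes>\<^sub>M lborel) \<rightarrow>\<^sub>M borel" by measurable
  then have "emeasure (distr (lborel \<Otimes>\<^sub>M lborel) borel ?Q) (box l u)
      = emeasure (lborel \<Otimes>\<^sub>M lborel) (?Q -` box l u \<inter> space (lborel \<Otimes>\<^sub>M lborel))"
    by (rule emeasure_distr) simp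
  also have "?Q -` box l u \<inter> space (lborel \<Otimes>\<^sub>M lborel) = {l $ 1<..<u $ 1} \<times> {l $ 2<..<u $ 2}"
    by (auto simp: mem_box_cart forall_2 axis_def space_pair_measure)
  also have "emeasure (lborel \<Otimes>\<^sub>M lborel) \<dots> = ennreal (u $ 1 - l $ 1) * ennreal (u $ 2 - l $ 2)"
    using le[of "axis 1 1"] le[of "axis 2 1"] B
    by (subst lborel.emeasure_pair_measure_Times) (auto simp: inner_axis)
  also have "\<dots> = (\<Prod>b\<in>Basis. (u - l) \<bullet> b)"
    using ne le[of "axis 1 1"] le[of "axis 2 1"] unfolding B by (simp add: inner_axis ennreal_mult)
  finally show "emeasure (distr (lborel \<Otimes>\<^sub>M lborel) borel ?Q) (box l u) = (\<Prod>b\<in>Basis. (u - l) \<bullet> b)" .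
qed simp

text \<open>For fixed \<open>t\<close> the map is a translation in \<open>u\<close>, so Tonelli and
  translation invariance suffice. The swap of coordinates is built in to match the oblique frames
  below.\<close>

lemma distr_lborel_shear:
  "distr (lborel \<Otimes>\<^sub>M lborel) (lborel \<Otimes>\<^sub>M lborel) (\<lambda>(u, t). (t, u + \<tau> * t :: real)) = lborel \<Otimes>\<^sub>M lborel"
    (is "distr ?L ?L ?S = _")
proof (rule measure_eqI)
  fix X assume "X \<in> sets (distr ?L ?L ?S)"
  then have X[measurable]: "X \<in> sets ?L" by simp
  have S: "?S \<in> ?L \<rightarrow>\<^sub>M ?L" by measurable
  have m: "(\<lambda>z. indicator X (?S z) :: ennreal) \<in> borel_measurable ?L"
    using S by measurable
  have shift: "(\<integral>\<^sup>+u. indicator X (t, u + \<tau> * t) \<partial>lborel) = (\<integral>\<^sup>+u. indicator X (t, u) \<partial>lborel)" for t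
  proof -
    have "(\<lambda>u. indicator X (t, u) :: ennreal) \<in> borel_measurable borel" by measurable
    from nn_integral_real_affine[OF this, of 1 "\<tau> * t"] show ?thesis
      by (simp add: add.commute)
  qed
  have "emeasure (distr ?L ?L ?S) X = (\<integral>\<^sup>+z. indicator X z \<partial>distr ?L ?L ?S)"
    by (rule nn_integral_indicator[symmetric]) (simp only: sets_distr X)
  also have "\<dots> = (\<integral>\<^sup>+z. indicator X (?S z) \<partial>?L)"
    by (rule nn_integral_distr[OF S]) measurable
  also have "\<dots> = (\<integral>\<^sup>+t. \<integral>\<^sup>+u. indicator X (t, u + \<tau> * t) \<partial>lborel \<partial>lborel)"
    using lborel_pair.nn_integral_snd[OF m] by (simp only: prod.case)
  also have "\<dots> = (\<integral>\<^sup>+t. \<integral>\<^sup>+u. indicator X (t, u) \<partial>lborel \<partial>lborel)"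
    by (simp only: shift)
  also have "\<dots> = emeasure ?L X"
    by (rule lborel.emeasure_pair_measure[OF X, symmetric])
  finally show "emeasure (distr ?L ?L ?S) X = emeasure ?L X" .
qed simp

text \<open>The lines of integration have direction \<open>v\<close> and are indexed by the coordinate along \<open>w\<close>;
  the linear map \<open>(u, t) \<mapsto> u *\<^sub>R w + t *\<^sub>R v\<close> has determinant of modulus 1.\<close>

definition line_frame :: "real^2 \<Rightarrow> real^2 \<Rightarrow> bool" where
  "line_frame v w \<longleftrightarrow> v = axis 2 1 \<and> w = axis 1 1 \<or> (\<exists>\<tau>. \<bar>\<tau>\<bar> \<le> 1 \<and> v = axis 1 1 + \<tau> *\<^sub>R axis 2 1 \<and> w = axis 2 1)"

lemma distr_lborel_line_frame:
  assumes "line_frame v w"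
  shows "distr (lborel \<Otimes>\<^sub>M lborel) borel (\<lambda>(u, t). q + u *\<^sub>R w + t *\<^sub>R v) = lborel"
proof -
  have *: "distr (lborel \<Otimes>\<^sub>M lborel) borel (\<lambda>(u, t). u *\<^sub>R w + t *\<^sub>R v) = lborel"
    using assms unfolding line_frame_def
  proof (elim disjE exE conjE)
    assume "v = axis 2 1" "w = axis 1 1"
    then show ?thesis using distr_lborel_axes by simp
  next
    fix \<tau> assume vw: "v = axis 1 1 + \<tau> *\<^sub>R axis 2 1" "w = axis 2 1"
    \<comment> \<open>With s = t and second coordinate u + \<open>\<tau>\<close> t, the oblique
      parametrisation is the shear followed by the parametrisation along the axes.\<close>
    have "distr (lborel \<Otimes>\<^sub>M lborel) borel (\<lambda>(u, t). u *\<^sub>R w + t *\<^sub>R v)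
        = distr (distr (lborel \<Otimes>\<^sub>M lborel) (lborel \<Otimes>\<^sub>M lborel) (\<lambda>(u, t). (t, u + \<tau> * t))) borel
            (\<lambda>(s, t). s *\<^sub>R axis 1 1 + t *\<^sub>R axis 2 1)"
      by (subst distr_distr) (measurable, auto simp: vw o_def split_beta' algebra_simps)
    also have "\<dots> = lborel" unfolding distr_lborel_shear by (rule distr_lborel_axes)
    finally show ?thesis .
  qed
  have "distr (lborel \<Otimes>\<^sub>M lborel) borel (\<lambda>(u, t). q + u *\<^sub>R w + t *\<^sub>R v)
      = distr (distr (lborel \<Otimes>\<^sub>M lborel) borel (\<lambda>(u, t). u *\<^sub>R w + t *\<^sub>R v)) borel ((+) q)"
    by (subst distr_distr) (measurable, auto simp: o_def split_beta' add.assoc)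
  then show ?thesis using lborel_distr_plus[of q] by (simp add: *)
qed

text \<open>Fubini in the coordinates of the frame. The line u = 0 has to be left out: the bound to
  be inserted is a multiple of 1 / sqrt |u|, which is 0 at u = 0 by the convention for division,
  whereas the line integral there need not vanish.\<close>

lemma norm_integral_le_of_line_bound:
  fixes f :: "real^2 \<Rightarrow> complex"
  assumes vw: "line_frame v w" and f: "integrable lborel f" and g: "integrable lborel g"
    and b: "\<And>u. u \<noteq> 0 \<Longrightarrow> norm (LINT t|lborel. f (q + u *\<^sub>R w + t *\<^sub>R v)) \<le> g u"
  shows "norm (LINT x|lborel. f x) \<le> (LINT u|lborel. g u)"
proof -
  let ?P = "\<lambda>(u, t). q + u *\<^sub>R w + t *\<^sub>R v"
  have P: "?P \<in> (lborel \<Otimes>\<^sub>M lborel) \<rightarrow>\<^sub>M borel" by measurable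
  have f': "integrable (distr (lborel \<Otimes>\<^sub>M lborel) borel ?P) f"
    using f distr_lborel_line_frame[OF vw] by simp
  have fP: "integrable (lborel \<Otimes>\<^sub>M lborel) (\<lambda>(u, t). f (q + u *\<^sub>R w + t *\<^sub>R v))"
    using integrable_distr[OF P f'] by (simp add: split_beta')
  have "(LINT x|lborel. f x) = (LINT x|distr (lborel \<Otimes>\<^sub>M lborel) borel ?P. f x)"
    using distr_lborel_line_frame[OF vw] by simp
  also have "\<dots> = (LINT z|(lborel \<Otimes>\<^sub>M lborel). f (?P z))"
    using f by (intro integral_distr[OF P]) auto
  also have "\<dots> = (LINT u|lborel. LINT t|lborel. f (q + u *\<^sub>R w + t *\<^sub>R v))"
    using lborel_pair.integral_fst[OF fP] by (simp add: split_beta')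
  finally have "norm (LINT x|lborel. f x) \<le> (LINT u|lborel. norm (LINT t|lborel. f (q + u *\<^sub>R w + t *\<^sub>R v)))"
    by simp
  also have "\<dots> \<le> (LINT u|lborel. g u)"
  proof (rule integral_mono_AE)
    show "integrable lborel (\<lambda>u. norm (LINT t|lborel. f (q + u *\<^sub>R w + t *\<^sub>R v)))"
      using lborel_pair.integrable_fst[OF fP] by simp
    show "AE u in lborel. norm (LINT t|lborel. f (q + u *\<^sub>R w + t *\<^sub>R v)) \<le> g u"
      using AE_lborel_singleton[of 0] by eventually_elim (use b in auto)
  qed (rule g)
  finally show ?thesis .
qed

lemma integrable_inverse_sqrt:
  "integrable lborel (\<lambda>u::real. indicator {-c..c} u / sqrt \<bar>u\<bar>)"
proof (cases "c \<ge> 0")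
  case True
  have "(\<lambda>x. x powr (-1/2)) integrable_on {0..c}"
    using has_integral_powr_from_0[of "-1/2" c] True by (auto simp: integrable_on_def)
  then have "(\<lambda>x. x powr (-1/2)) absolutely_integrable_on {0..c}"
    by (rule nonnegative_absolutely_integrable_1) auto
  then have "integrable lebesgue (\<lambda>x. indicator {0..c} x *\<^sub>R x powr (-1/2))"
    by (simp add: set_integrable_def)
  then have 0: "integrable lborel (\<lambda>x. indicator {0..c} x *\<^sub>R x powr (-1/2))"
    by (subst (asm) integrable_completion) auto
  have p: "x powr - (1/2) = 1 / sqrt x" if "x \<ge> 0" for x :: real
    using that by (simp add: powr_minus powr_half_sqrt inverse_eq_divide)
  have 1: "integrable lborel (\<lambda>u. indicator {0..c} u / sqrt \<bar>u\<bar>)"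
    by (rule Bochner_Integration.integrable_bound[OF 0]) (auto simp: p indicator_def)
  from lborel_integrable_real_affine[OF this, of "-1" 0]
  have 2: "integrable lborel (\<lambda>u::real. indicator {0..c} (- u) / sqrt \<bar>u\<bar>)" by simp
  show ?thesis
    by (rule Bochner_Integration.integrable_bound[OF Bochner_Integration.integrable_add[OF 1 2]])
       (auto simp: indicator_def)
qed simp

section \<open>Phases close to the D4 normal form\<close>

lemma has_vector_derivative_along_line:
  fixes f :: "real^2 \<Rightarrow> 'b::real_normed_vector"
  assumes "(f has_derivative (\<lambda>h. h $ 1 *\<^sub>R a + h $ 2 *\<^sub>R b)) (at (z + t *\<^sub>R v))"
  shows "((\<lambda>t. f (z + t *\<^sub>R v)) has_vector_derivative (v $ 1 *\<^sub>R a + v $ 2 *\<^sub>R b)) (at t within S)"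
proof -
  have "((\<lambda>t. z + t *\<^sub>R v) has_derivative (\<lambda>s. s *\<^sub>R v)) (at t within S)"
    by (auto intro!: derivative_eq_intros)
  from has_derivative_compose[OF this assms] show ?thesis
    unfolding has_vector_derivative_def by (simp add: scaleR_add_right)
qed

lemma has_real_derivative_along_line:
  fixes f :: "real^2 \<Rightarrow> real"
  assumes "(f has_derivative (\<lambda>h. h $ 1 * a + h $ 2 * b)) (at (z + t *\<^sub>R v))"
  shows "((\<lambda>t. f (z + t *\<^sub>R v)) has_real_derivative (v $ 1 * a + v $ 2 * b)) (at t within S)"
  using has_vector_derivative_along_line[of f a b z t v S] assms
  by (simp add: has_real_derivative_iff_has_vector_derivative)

lemma norm_real2_le: "norm (y :: real^2) \<le> \<bar>y $ 1\<bar> + \<bar>y $ 2\<bar>"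
  using norm_le_l1_cart[of y] by (simp add: sum_2)

lemma AE_lborel_hyperplane:
  assumes "a \<noteq> (0::'a::euclidean_space)"
  shows "AE x in lborel. a \<bullet> x \<noteq> b"
proof (rule AE_I')
  show "{x. a \<bullet> x = b} \<in> null_sets lborel"
    using negligible_hyperplane[of a b] assms closed_hyperplane[of a b]
    by (simp add: negligible_iff_null_sets null_sets_completion_iff)
qed auto

text \<open>The two sign conditions amount to |t| <= c u = |u|. The error is therefore at most |u| /
  4, which leaves c C >= 2 |u| - |u| / 4.\<close>

lemma vertical_hess_bound:
  fixes c u t C :: real
  assumes "c = 1 \<or> c = -1" "0 \<le> c * (u - t)" "0 \<le> c * (u + t)" "\<bar>C - 2 * u\<bar> \<le> (\<bar>u\<bar> + \<bar>t\<bar>) / 8"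
  shows "\<bar>u\<bar> / 2 \<le> c * C"
proof -
  have t: "\<bar>t\<bar> \<le> c * u" using assms(1-3) by (elim disjE) auto
  have u: "\<bar>u\<bar> = c * u" using t assms(1) by (elim disjE) auto
  have "\<bar>c * (C - 2 * u)\<bar> = \<bar>C - 2 * u\<bar>" using assms(1) by (elim disjE) auto
  then have "- (c * (C - 2 * u)) \<le> (\<bar>u\<bar> + \<bar>t\<bar>) / 8" using assms(4) by (metis abs_ge_minus_self order_trans)
  moreover have "c * C = 2 * (c * u) + c * (C - 2 * u)" by (simp add: algebra_simps)
  ultimately show ?thesis using t unfolding u by argo
qed

text \<open>Put Y = d y = |y| and r = s t, so that |r| <= Y. Every error is at most Y / 4, and
  \<open>s * \<kappa>\<close> has the favourable sign. The mixed term gives at least 4 Y - Y / 2, so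
  the right-hand side is at least 3 Y + 2 r, while |u| = Y - r. The claim (Y - r) / 2 <= 3 Y + 2 r
  is equivalent to r >= -Y. Equality at r = -Y shows how the error constant 1/8 and the factor 1/2
  are matched.\<close>

lemma oblique_hess_bound:
  fixes s d \<kappa> A B C t y u :: real
  assumes s: "s = 1 \<or> s = -1" and d: "d = 1 \<or> d = -1" and \<kappa>: "0 \<le> s * \<kappa>"
    and "\<bar>A - \<kappa>\<bar> \<le> (\<bar>t\<bar> + \<bar>y\<bar>) / 8" "\<bar>B - 2 * y\<bar> \<le> (\<bar>t\<bar> + \<bar>y\<bar>) / 8" "\<bar>C - 2 * t\<bar> \<le> (\<bar>t\<bar> + \<bar>y\<bar>) / 8"
    and t: "\<bar>t\<bar> \<le> d * y" and u: "y = u + t * (d * s)"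
  shows "\<bar>u\<bar> / 2 \<le> s * (A + 2 * (d * s) * B + C)"
proof -
  define Y where "Y = d * y"
  have "\<bar>y\<bar> = Y" using d t unfolding Y_def by (elim disjE) auto
  then have M: "(\<bar>t\<bar> + \<bar>y\<bar>) / 8 \<le> Y / 4" using t unfolding Y_def[symmetric] by simp
  have bounds: "- (Y / 4) \<le> A - \<kappa>" "A - \<kappa> \<le> Y / 4" "- (Y / 4) \<le> B - 2 * y" "B - 2 * y \<le> Y / 4"
      "- (Y / 4) \<le> C - 2 * t" "C - 2 * t \<le> Y / 4" "- Y \<le> t" "t \<le> Y"
    using assms(4-6) M t unfolding Y_def[symmetric] by linarith+
  have "u = y - t * (d * s)" using u by simp
  with s d \<kappa> bounds Y_def show ?thesis by (elim disjE; (simp; fail | (simp, linarith)))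
qed

text \<open>The Hessian entries of x_1 x_2^2 are 0, 2 x_2 and 2 x_1. Comparing differences of
  entries, and not the entries themselves, lets the base point move to the degenerate point and
  leaves the size of \<open>\<phi>11\<close> open. The shared \<open>\<phi>12\<close> in
  \<open>deriv1\<close> and \<open>deriv2\<close> expresses the symmetry of the Hessian. The
  constant 1/8 is the one that \<open>oblique_hess_bound\<close> can absorb.\<close>

locale near_D4_phase =
  fixes \<phi> \<phi>1 \<phi>2 \<phi>11 \<phi>12 \<phi>22 :: "real^2 \<Rightarrow> real" and R :: real
  assumes R: "0 < R" "R \<le> 1"
    and deriv: "\<And>x. x \<in> ball 0 R \<Longrightarrow> (\<phi> has_derivative (\<lambda>h. h $ 1 * \<phi>1 x + h $ 2 * \<phi>2 x)) (at x)"
    and deriv1: "\<And>x. x \<in> ball 0 R \<Longrightarrow> (\<phi>1 has_derivative (\<lambda>h. h $ 1 * \<phi>11 x + h $ 2 * \<phi>12 x)) (at x)"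
    and deriv2: "\<And>x. x \<in> ball 0 R \<Longrightarrow> (\<phi>2 has_derivative (\<lambda>h. h $ 1 * \<phi>12 x + h $ 2 * \<phi>22 x)) (at x)"
    and lip11: "\<And>x y. x \<in> ball 0 R \<Longrightarrow> y \<in> ball 0 R \<Longrightarrow> \<bar>\<phi>11 x - \<phi>11 y\<bar> \<le> norm (x - y) / 8"
    and lip12: "\<And>x y. x \<in> ball 0 R \<Longrightarrow> y \<in> ball 0 R \<Longrightarrow> \<bar>\<phi>12 x - \<phi>12 y - 2 * (x - y) $ 2\<bar> \<le> norm (x - y) / 8"
    and lip22: "\<And>x y. x \<in> ball 0 R \<Longrightarrow> y \<in> ball 0 R \<Longrightarrow> \<bar>\<phi>22 x - \<phi>22 y - 2 * (x - y) $ 1\<bar> \<le> norm (x - y) / 8"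
    and small: "\<bar>\<phi>12 0\<bar> \<le> R / 16" "\<bar>\<phi>22 0\<bar> \<le> R / 16"
begin

lemma cball_subset: "cball 0 (R / 2) \<subseteq> ball (0 :: real^2) R"
  using R by auto

text \<open>The map \<open>(\<phi>22 / 2, \<phi>12 / 2)\<close> is a small Lipschitz perturbation of the identity,
  hence has a zero.\<close>

lemma degenerate_point: obtains p where "p \<in> cball 0 (R / 2)" "\<phi>12 p = 0" "\<phi>22 p = 0"
proof -
  define G where "G = (\<lambda>x. (\<phi>22 x / 2) *\<^sub>R axis 1 1 + (\<phi>12 x / 2) *\<^sub>R axis 2 1 :: real^2)"
  have G: "G x $ 1 = \<phi>22 x / 2" "G x $ 2 = \<phi>12 x / 2" for x
    by (simp_all add: G_def axis_def)
  \<comment> \<open>Halving turns the leading parts 2 x_1 and 2 x_2 into x_1 and x_2; each component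
    of the remainder is then at most \<open>norm (x - y) / 16\<close>.\<close>
  have contr: "norm ((x - G x) - (y - G y)) \<le> 1 / 8 * norm (x - y)" if "x \<in> ball 0 R" "y \<in> ball 0 R" for x y
    using norm_real2_le[of "(x - G x) - (y - G y)"] lip12[OF that] lip22[OF that]
    unfolding vector_minus_component G by (simp add: abs_le_iff field_simps abs_if split: if_splits)
  have "\<exists>!x\<in>cball 0 (R / 2). x - G x = x"
  proof (rule Banach_fix[where c = "1/8"])
    show "(\<lambda>x. x - G x) ` cball 0 (R / 2) \<subseteq> cball 0 (R / 2)"
    proof clarsimp
      fix x :: "real^2" assume x: "norm x * 2 \<le> R"
      \<comment> \<open>The value at the origin gives R / 16 and the contraction another (1/8) (R /
        2), together R / 8, so the closed ball of radius R / 2 is mapped into itself.\<close>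
      have "norm (G 0) \<le> R / 16" using norm_real2_le[of "G 0"] small unfolding G by simp
      moreover have "norm ((x - G x) - (0 - G 0)) \<le> 1 / 8 * norm (x - 0)"
        by (rule contr) (use x R in auto)
      moreover have "norm (x - G x) \<le> norm ((x - G x) - (0 - G 0)) + norm (G 0)"
        using norm_triangle_ineq[of "(x - G x) - (0 - G 0)" "- G 0"] by simp
      ultimately show "norm (x - G x) * 2 \<le> R" using x R unfolding diff_zero by linarith
    qed
    show "dist (x - G x) (y - G y) \<le> 1/8 * dist x y" if "x \<in> cball 0 (R / 2)" "y \<in> cball 0 (R / 2)" for x y
      unfolding dist_norm using contr that cball_subset by blast
  qed (use R in \<open>auto simp: complete_eq_closed\<close>)
  then obtain x where x: "x \<in> cball 0 (R / 2)" "G x = 0" by auto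
  from arg_cong[OF x(2), of "\<lambda>z. z $ 1"] arg_cong[OF x(2), of "\<lambda>z. z $ 2"]
  show ?thesis using x(1) unfolding G by (intro that) auto
qed

text \<open>Convexity makes the line meet \<open>K\<close> in a single interval, so van der Corput
  is applied only once. The length of this interval is at most 1 because \<open>K\<close> has
  diameter at most \<open>R\<close> and \<open>v\<close> has norm at least 1. The amplitude has
  derivative at most 2 N along the line, whence 10 (N + 2 N) = 30 N.\<close>

lemma line_bound:
  fixes a a1 a2 :: "real^2 \<Rightarrow> complex"
  assumes l: "l \<noteq> 0" and K: "compact K" "convex K" "K \<subseteq> cball 0 (R / 2)"
    and s: "s = 1 \<or> s = -1" and v: "1 \<le> norm v" "\<bar>v $ 1\<bar> \<le> 1" "\<bar>v $ 2\<bar> \<le> 1" and "\<mu> > 0"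
    and hess: "\<And>t. z + t *\<^sub>R v \<in> K \<Longrightarrow> \<mu> \<le> s * (v $ 1 * (v $ 1 * \<phi>11 (z + t *\<^sub>R v) + v $ 2 * \<phi>12 (z + t *\<^sub>R v))
        + v $ 2 * (v $ 1 * \<phi>12 (z + t *\<^sub>R v) + v $ 2 * \<phi>22 (z + t *\<^sub>R v)))"
    and a: "\<And>x. (a has_derivative (\<lambda>h. h $ 1 *\<^sub>R a1 x + h $ 2 *\<^sub>R a2 x)) (at x)"
    and N: "\<And>x. x \<in> cball 0 (R / 2) \<Longrightarrow> norm (a x) \<le> N \<and> norm (a1 x) \<le> N \<and> norm (a2 x) \<le> N"
  shows "norm (LINT t|lborel. indicator K (z + t *\<^sub>R v) *\<^sub>R (exp (\<i> * of_real (l * \<phi> (z + t *\<^sub>R v))) * a (z + t *\<^sub>R v)))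
      \<le> 30 * N / sqrt (\<bar>l\<bar> * \<mu>)"
proof -
  define T where "T = {t. z + t *\<^sub>R v \<in> K}"
  define g where "g = (\<lambda>t. exp (\<i> * complex_of_real (l * \<phi> (z + t *\<^sub>R v))) * a (z + t *\<^sub>R v))"
  have "N \<ge> 0" using N[of 0] R order_trans[OF norm_ge_zero] by auto
  have T0: "T = (\<lambda>t. z + t *\<^sub>R v) -` K" unfolding T_def by auto
  have "closed T" unfolding T0
    by (intro closed_vimage compact_imp_closed K) (auto intro!: continuous_intros)
  have dist_T: "\<bar>t - t'\<bar> \<le> 1" if "t \<in> T" "t' \<in> T" for t t'
  proof -
    have "norm (z + t *\<^sub>R v) \<le> R / 2" "norm (z + t' *\<^sub>R v) \<le> R / 2"
      using that K(3) by (auto simp: T_def)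
    then have "norm ((z + t *\<^sub>R v) - (z + t' *\<^sub>R v)) \<le> R"
      using norm_triangle_ineq4[of "z + t *\<^sub>R v" "z + t' *\<^sub>R v"] by linarith
    moreover have "(z + t *\<^sub>R v) - (z + t' *\<^sub>R v) = (t - t') *\<^sub>R v" by (simp add: algebra_simps)
    ultimately have "\<bar>t - t'\<bar> * norm v \<le> R" by simp
    moreover have "\<bar>t - t'\<bar> \<le> \<bar>t - t'\<bar> * norm v" using mult_left_mono[OF v(1), of "\<bar>t - t'\<bar>"] by simp
    ultimately show ?thesis using R(2) by (meson order_trans)
  qed
  have "bounded T"
  proof (cases "T = {}")
    case False
    then obtain t' where "t' \<in> T" by blast
    then have "T \<subseteq> cball t' 1" using dist_T[of t'] by (auto simp: dist_real_def)
    then show ?thesis using bounded_subset bounded_cball by blast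
  qed simp
  have "convex T"
    unfolding convex_alt T_def
  proof clarsimp
    fix t t' r :: real
    assume "z + t *\<^sub>R v \<in> K" "z + t' *\<^sub>R v \<in> K" "0 \<le> r" "r \<le> 1"
    then have "(1 - r) *\<^sub>R (z + t *\<^sub>R v) + r *\<^sub>R (z + t' *\<^sub>R v) \<in> K"
      using K(2) unfolding convex_alt by blast
    then show "z + ((1 - r) * t + r * t') *\<^sub>R v \<in> K" by (simp add: algebra_simps)
  qed
  with \<open>closed T\<close> \<open>bounded T\<close> obtain \<alpha> \<beta> where T: "T = {\<alpha>..\<beta>}"
    using connected_compact_interval_1 convex_connected compact_eq_bounded_closed by metis
  have "(LINT t|lborel. indicator K (z + t *\<^sub>R v) *\<^sub>R g t) = (LINT t:T|lborel. g t)"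
    unfolding set_lebesgue_integral_def T_def indicator_def by simp
  moreover have "norm (LINT t:T|lborel. g t) \<le> 30 * N / sqrt (\<bar>l\<bar> * \<mu>)"
  proof (cases "\<alpha> \<le> \<beta>")
    case True
    have inK: "z + t *\<^sub>R v \<in> K" and inb: "z + t *\<^sub>R v \<in> ball 0 R" "z + t *\<^sub>R v \<in> cball 0 (R / 2)" if "t \<in> {\<alpha>..\<beta>}" for t
      using that K(3) cball_subset unfolding T[symmetric] T_def by auto
    note d0 = has_real_derivative_along_line[OF deriv[OF inb(1)], of _ "{\<alpha>..\<beta>}"]
    have d1: "((\<lambda>t. l * \<phi> (z + t *\<^sub>R v)) has_real_derivative l * (v $ 1 * \<phi>1 (z + t *\<^sub>R v) + v $ 2 * \<phi>2 (z + t *\<^sub>R v))) (at t within {\<alpha>..\<beta>})"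
      if "t \<in> {\<alpha>..\<beta>}" for t by (rule DERIV_cmult[OF d0[OF that]])
    have d2: "((\<lambda>t. l * (v $ 1 * \<phi>1 (z + t *\<^sub>R v) + v $ 2 * \<phi>2 (z + t *\<^sub>R v))) has_real_derivative
        l * (v $ 1 * (v $ 1 * \<phi>11 (z + t *\<^sub>R v) + v $ 2 * \<phi>12 (z + t *\<^sub>R v))
        + v $ 2 * (v $ 1 * \<phi>12 (z + t *\<^sub>R v) + v $ 2 * \<phi>22 (z + t *\<^sub>R v)))) (at t within {\<alpha>..\<beta>})"
      if "t \<in> {\<alpha>..\<beta>}" for t
      by (intro DERIV_cmult DERIV_add has_real_derivative_along_line deriv1 deriv2 inb that)
    have d3: "((\<lambda>t. a (z + t *\<^sub>R v)) has_vector_derivative v $ 1 *\<^sub>R a1 (z + t *\<^sub>R v) + v $ 2 *\<^sub>R a2 (z + t *\<^sub>R v)) (at t within {\<alpha>..\<beta>})"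
      for t by (rule has_vector_derivative_along_line[OF a])
    have N': "norm (v $ 1 *\<^sub>R a1 (z + t *\<^sub>R v) + v $ 2 *\<^sub>R a2 (z + t *\<^sub>R v)) \<le> 2 * N" if "t \<in> {\<alpha>..\<beta>}" for t
    proof -
      have "norm (v $ 1 *\<^sub>R a1 (z + t *\<^sub>R v) + v $ 2 *\<^sub>R a2 (z + t *\<^sub>R v))
          \<le> \<bar>v $ 1\<bar> * norm (a1 (z + t *\<^sub>R v)) + \<bar>v $ 2\<bar> * norm (a2 (z + t *\<^sub>R v))"
        by (rule order_trans[OF norm_triangle_ineq]) simp
      also have "\<dots> \<le> 1 * N + 1 * N"
        using N[OF inb(2)[OF that]] v by (intro add_mono mult_mono) auto
      finally show ?thesis by simp
    qed
    have cont: "continuous_on {\<alpha>..\<beta>} g" unfolding g_def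
      by (intro continuous_intros DERIV_continuous_on[OF d0] continuous_on_vector_derivative[OF d3])
    have "set_integrable lborel T g"
      unfolding T set_integrable_def by (rule borel_integrable_compact[OF compact_Icc cont])
    from set_borel_integral_eq_integral(2)[OF this]
    have "(LINT t:T|lborel. g t) = integral {\<alpha>..\<beta>} g" unfolding T .
    also have "norm \<dots> \<le> 10 / sqrt (\<bar>l\<bar> * \<mu>) * (N + 2 * N * (\<beta> - \<alpha>))"
      unfolding g_def
    proof (rule van_der_Corput_amplitude[OF True _ _ d1 d2 _ d3 _ N', where s = "s * sgn l"])
      show "0 < \<bar>l\<bar> * \<mu>" using l \<open>\<mu> > 0\<close> by simp
      \<comment> \<open>The phase carries the factor \<open>l\<close>, so the sign of its second
        derivative is that of the Hessian form times the sign of \<open>l\<close>.\<close>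
      show "s * sgn l = 1 \<or> s * sgn l = - 1" using s l by (auto simp: sgn_if)
      show "norm (a (z + \<beta> *\<^sub>R v)) \<le> N" using N inb(2) True by auto
      fix t assume t: "t \<in> {\<alpha>..\<beta>}"
      let ?h = "v $ 1 * (v $ 1 * \<phi>11 (z + t *\<^sub>R v) + v $ 2 * \<phi>12 (z + t *\<^sub>R v))
        + v $ 2 * (v $ 1 * \<phi>12 (z + t *\<^sub>R v) + v $ 2 * \<phi>22 (z + t *\<^sub>R v))"
      have "\<bar>l\<bar> * \<mu> \<le> \<bar>l\<bar> * (s * ?h)" by (intro mult_left_mono hess inK t) auto
      also have "\<dots> = s * sgn l * (l * ?h)" by (simp add: abs_sgn mult_ac)
      finally show "\<bar>l\<bar> * \<mu> \<le> s * sgn l * (l * ?h)" .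
    qed auto
    also have "\<dots> \<le> 10 / sqrt (\<bar>l\<bar> * \<mu>) * (N + 2 * N * 1)"
      using \<open>N \<ge> 0\<close> dist_T[of \<beta> \<alpha>] True l \<open>\<mu> > 0\<close> unfolding T
      by (intro mult_left_mono add_mono) auto
    finally show ?thesis by simp
  next
    case False
    then show ?thesis using T \<open>N \<ge> 0\<close> l \<open>\<mu> > 0\<close> by (simp add: set_lebesgue_integral_def)
  qed
  ultimately show ?thesis unfolding g_def by simp
qed

section \<open>Integration over one convex piece of the ball\<close>

abbreviation hess :: "real^2 \<Rightarrow> real^2 \<Rightarrow> real" where
  "hess v x \<equiv> v $ 1 * (v $ 1 * \<phi>11 x + v $ 2 * \<phi>12 x) + v $ 2 * (v $ 1 * \<phi>12 x + v $ 2 * \<phi>22 x)"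

lemma continuous_on_phase: "continuous_on (cball 0 (R / 2)) \<phi>"
  using deriv cball_subset has_derivative_continuous
  by (intro continuous_at_imp_continuous_on) blast

lemma line_frame_bounds:
  assumes "line_frame v w"
  shows "1 \<le> norm v" "\<bar>v $ 1\<bar> \<le> 1" "\<bar>v $ 2\<bar> \<le> 1"
    and "norm (u *\<^sub>R w + t *\<^sub>R v) \<le> 1 \<Longrightarrow> \<bar>u\<bar> \<le> 2"
proof -
  show "1 \<le> norm v" "\<bar>v $ 1\<bar> \<le> 1" "\<bar>v $ 2\<bar> \<le> 1"
    using assms component_le_norm_cart[of v 1] component_le_norm_cart[of v 2] unfolding line_frame_def by (auto simp: axis_def)
  assume n: "norm (u *\<^sub>R w + t *\<^sub>R v) \<le> 1"
  have c: "\<bar>(u *\<^sub>R w + t *\<^sub>R v) $ i\<bar> \<le> 1" for i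
    using component_le_norm_cart[of "u *\<^sub>R w + t *\<^sub>R v" i] n by linarith
  show "\<bar>u\<bar> \<le> 2"
    using assms unfolding line_frame_def
  proof (elim disjE exE conjE)
    fix \<tau> assume \<tau>: "\<bar>\<tau>\<bar> \<le> 1" "v = axis 1 1 + \<tau> *\<^sub>R axis 2 1" "w = axis 2 1"
    have "\<bar>t\<bar> \<le> 1" "\<bar>u + t * \<tau>\<bar> \<le> 1" using c[of 1] c[of 2] unfolding \<tau> by (simp_all add: axis_def)
    moreover have "\<bar>t * \<tau>\<bar> \<le> 1" unfolding abs_mult using \<open>\<bar>t\<bar> \<le> 1\<close> \<tau>(1) by (simp add: mult_le_one)
    ultimately show ?thesis by linarith
  qed (use c[of 1] in \<open>simp add: axis_def\<close>)
qed

text \<open>On each line \<open>line_bound\<close> applies with \<open>\<mu>\<close> = |u| / 2,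
  which is where sqrt 2 comes from; the result is then integrated in \<open>u\<close>. Points of
  \<open>K\<close> are at distance at most R <= 1 from \<open>p\<close>, so by
  \<open>line_frame_bounds\<close> lines with |u| > 2 miss \<open>K\<close>.\<close>

lemma sector_bound:
  fixes a a1 a2 :: "real^2 \<Rightarrow> complex"
  assumes l: "l \<noteq> 0" and K: "compact K" "convex K" "K \<subseteq> cball 0 (R / 2)"
    and p: "p \<in> cball 0 (R / 2)" and s: "s = 1 \<or> s = -1" and vw: "line_frame v w"
    and hess: "\<And>u t. p + u *\<^sub>R w + t *\<^sub>R v \<in> K \<Longrightarrow> \<bar>u\<bar> / 2 \<le> s * hess v (p + u *\<^sub>R w + t *\<^sub>R v)"
    and a: "\<And>x. (a has_derivative (\<lambda>h. h $ 1 *\<^sub>R a1 x + h $ 2 *\<^sub>R a2 x)) (at x)"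
    and N: "\<And>x. x \<in> cball 0 (R / 2) \<Longrightarrow> norm (a x) \<le> N \<and> norm (a1 x) \<le> N \<and> norm (a2 x) \<le> N"
  shows "norm (LINT x|lborel. indicator K x *\<^sub>R (exp (\<i> * of_real (l * \<phi> x)) * a x))
      \<le> 30 * sqrt 2 * (LINT u|lborel. indicator {-2..2} u / sqrt \<bar>u\<bar>) * N / sqrt \<bar>l\<bar>"
proof -
  let ?f = "\<lambda>x. indicator K x *\<^sub>R (exp (\<i> * of_real (l * \<phi> x)) * a x)"
  let ?c = "30 * sqrt 2 * N / sqrt \<bar>l\<bar>"
  have "N \<ge> 0" using N[of 0] R order_trans[OF norm_ge_zero] by auto
  have "continuous_on UNIV a"
    using a has_derivative_continuous by (intro continuous_at_imp_continuous_on) blast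
  then have "continuous_on K (\<lambda>x. exp (\<i> * of_real (l * \<phi> x)) * a x)"
    by (intro continuous_intros continuous_on_subset[OF continuous_on_phase K(3)]) (auto intro: continuous_on_subset)
  from borel_integrable_compact[OF K(1) this] have "integrable lborel ?f" .
  moreover have "integrable lborel (\<lambda>u::real. ?c * (indicator {-2..2} u / sqrt \<bar>u\<bar>))"
    by (intro integrable_mult_right integrable_inverse_sqrt)
  ultimately have "norm (LINT x|lborel. ?f x) \<le> (LINT u|lborel. ?c * (indicator {-2..2} u / sqrt \<bar>u\<bar>))"
  proof (rule norm_integral_le_of_line_bound[OF vw, where q = p])
    fix u :: real assume "u \<noteq> 0"
    show "norm (LINT t|lborel. ?f (p + u *\<^sub>R w + t *\<^sub>R v)) \<le> ?c * (indicator {-2..2} u / sqrt \<bar>u\<bar>)"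
    proof (cases "\<bar>u\<bar> \<le> 2")
      case True
      have "norm (LINT t|lborel. ?f (p + u *\<^sub>R w + t *\<^sub>R v)) \<le> 30 * N / sqrt (\<bar>l\<bar> * (\<bar>u\<bar> / 2))"
        by (rule line_bound[OF l K s line_frame_bounds(1-3)[OF vw] _ hess a N])
           (use \<open>u \<noteq> 0\<close> in auto)
      also have "\<dots> = ?c * (1 / sqrt \<bar>u\<bar>)"
        by (simp add: real_sqrt_mult real_sqrt_divide)
      finally show ?thesis using True by (auto simp: indicator_def abs_le_iff)
    next
      case False
      have "p + u *\<^sub>R w + t *\<^sub>R v \<notin> K" for t
      proof
        assume "p + u *\<^sub>R w + t *\<^sub>R v \<in> K"
        then have "norm (p + u *\<^sub>R w + t *\<^sub>R v) \<le> R / 2" "norm p \<le> R / 2" using K(3) p by auto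
        then have "norm (u *\<^sub>R w + t *\<^sub>R v) \<le> 1"
          using norm_triangle_ineq4[of "p + u *\<^sub>R w + t *\<^sub>R v" p] R by (simp add: add.assoc)
        from line_frame_bounds(4)[OF vw this] False show False by simp
      qed
      moreover have "u \<notin> {-2..2}" using False by auto
      ultimately show ?thesis by simp
    qed
  qed
  also have "\<dots> = 30 * sqrt 2 * (LINT u|lborel. indicator {-2..2} u / sqrt \<bar>u\<bar>) * N / sqrt \<bar>l\<bar>"
    unfolding integral_mult_right_zero by (simp add: mult_ac)
  finally show ?thesis .
qed

text \<open>With y = x - p and signs \<open>c\<close>, \<open>d\<close>: for \<open>c = d\<close>
  this is the part of the ball where c y_1 >= |y_2|, and for \<open>c = - d\<close> the part where d
  y_2 >= |y_1|.\<close>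

definition sector :: "real^2 \<Rightarrow> real \<Rightarrow> real \<Rightarrow> (real^2) set" where
  "sector p c d = cball 0 (R / 2) \<inter> {x. 0 \<le> c * ((x - p) $ 1 - (x - p) $ 2) \<and> 0 \<le> d * ((x - p) $ 1 + (x - p) $ 2)}"

lemma compact_sector: "compact (sector p c d)"
proof -
  have "closed {x. 0 \<le> c * ((x - p) $ 1 - (x - p) $ 2) \<and> 0 \<le> d * ((x - p) $ 1 + (x - p) $ 2)}"
    by (intro closed_Collect_conj closed_Collect_le continuous_intros)
  then show ?thesis unfolding sector_def by (intro compact_Int_closed compact_cball)
qed

lemma convex_sector: "convex (sector p c d)"
proof -
  have "convex {x :: real^2. 0 \<le> \<gamma> * ((x - p) $ 1 + \<delta> * (x - p) $ 2)}" for \<gamma> \<delta>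
  proof -
    have "{x :: real^2. 0 \<le> \<gamma> * ((x - p) $ 1 + \<delta> * (x - p) $ 2)}
        = (\<lambda>x. \<gamma> * (x $ 1 + \<delta> * x $ 2)) -` {\<gamma> * (p $ 1 + \<delta> * p $ 2)..}"
      by (auto simp: algebra_simps)
    then show ?thesis
      by (auto intro!: convex_linear_vimage linearI simp: algebra_simps)
  qed
  moreover have "sector p c d = cball 0 (R / 2) \<inter> ({x. 0 \<le> c * ((x - p) $ 1 + (-1) * (x - p) $ 2)}
      \<inter> {x. 0 \<le> d * ((x - p) $ 1 + 1 * (x - p) $ 2)})"
    unfolding sector_def by (auto simp: algebra_simps)
  ultimately show ?thesis by (simp only: convex_Int convex_cball)
qed

text \<open>For \<open>c = d\<close> the entry \<open>\<phi>22\<close>, close to 2 y_1, has sign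
  \<open>c\<close>, and vertical lines with u = y_1 work. For \<open>c = - d\<close> the mixed
  entry, close to 2 y_2 and of sign \<open>d\<close>, decides, and the transversal coordinate is u =
  y_2 - \<open>\<tau>\<close> y_1.\<close>

lemma sector_hess:
  assumes p: "p \<in> cball 0 (R / 2)" "\<phi>12 p = 0" "\<phi>22 p = 0"
    and c: "c = 1 \<or> c = -1" and d: "d = 1 \<or> d = -1"
  obtains s v w where "s = 1 \<or> s = -1" "line_frame v w"
    "\<And>u t. p + u *\<^sub>R w + t *\<^sub>R v \<in> sector p c d \<Longrightarrow> \<bar>u\<bar> / 2 \<le> s * hess v (p + u *\<^sub>R w + t *\<^sub>R v)"
proof -
  have approx: "\<bar>\<phi>11 x - \<phi>11 p\<bar> \<le> (\<bar>(x - p) $ 1\<bar> + \<bar>(x - p) $ 2\<bar>) / 8"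
      "\<bar>\<phi>12 x - 2 * (x - p) $ 2\<bar> \<le> (\<bar>(x - p) $ 1\<bar> + \<bar>(x - p) $ 2\<bar>) / 8"
      "\<bar>\<phi>22 x - 2 * (x - p) $ 1\<bar> \<le> (\<bar>(x - p) $ 1\<bar> + \<bar>(x - p) $ 2\<bar>) / 8"
    if "x \<in> sector p c d" for x
  proof -
    have xp: "x \<in> ball 0 R" "p \<in> ball 0 R" using that p(1) cball_subset unfolding sector_def by blast+
    have n: "norm (x - p) / 8 \<le> (\<bar>(x - p) $ 1\<bar> + \<bar>(x - p) $ 2\<bar>) / 8"
      using norm_real2_le[of "x - p"] by simp
    show "\<bar>\<phi>11 x - \<phi>11 p\<bar> \<le> (\<bar>(x - p) $ 1\<bar> + \<bar>(x - p) $ 2\<bar>) / 8"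
      by (rule order_trans[OF lip11[OF xp] n])
    show "\<bar>\<phi>12 x - 2 * (x - p) $ 2\<bar> \<le> (\<bar>(x - p) $ 1\<bar> + \<bar>(x - p) $ 2\<bar>) / 8"
      using order_trans[OF lip12[OF xp] n] p(2) by simp
    show "\<bar>\<phi>22 x - 2 * (x - p) $ 1\<bar> \<le> (\<bar>(x - p) $ 1\<bar> + \<bar>(x - p) $ 2\<bar>) / 8"
      using order_trans[OF lip22[OF xp] n] p(3) by simp
  qed
  show ?thesis
  proof (cases "c = d")
    case True
    show ?thesis
    proof (rule that[of c "axis 2 1" "axis 1 1"])
      fix u t assume x: "p + u *\<^sub>R axis 1 1 + t *\<^sub>R axis 2 1 \<in> sector p c d" (is "?x \<in> _")
      have y: "(?x - p) $ 1 = u" "(?x - p) $ 2 = t" by (simp_all add: axis_def)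
      have "0 \<le> c * (u - t)" "0 \<le> c * (u + t)"
        using x True unfolding sector_def Int_iff mem_Collect_eq y by auto
      moreover have "hess (axis 2 1) ?x = \<phi>22 ?x" by (simp add: axis_def)
      ultimately show "\<bar>u\<bar> / 2 \<le> c * hess (axis 2 1) ?x"
        using vertical_hess_bound[OF c _ _ approx(3)[OF x, unfolded y]] by (simp only:)
    qed (use c in \<open>auto simp: line_frame_def\<close>)
  next
    case False
    \<comment> \<open>The direction \<open>\<tau>\<close> is chosen so that \<open>2 * \<tau> * \<phi>12\<close> has on this sector the sign of \<open>\<phi>11 p\<close>, of which
      no bound is available; then the two terms cannot cancel.\<close>
    define s :: real where "s = (if \<phi>11 p \<ge> 0 then 1 else -1)"
    have s: "s = 1 \<or> s = -1" by (simp add: s_def)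
    define \<tau> where "\<tau> = d * s"
    have \<tau>: "\<tau> = 1 \<or> \<tau> = -1" using s d by (auto simp: \<tau>_def)
    show ?thesis
    proof (rule that[of s "axis 1 1 + \<tau> *\<^sub>R axis 2 1" "axis 2 1"])
      show "line_frame (axis 1 1 + \<tau> *\<^sub>R axis 2 1) (axis 2 1)" using \<tau> unfolding line_frame_def by auto
      fix u t assume x: "p + u *\<^sub>R axis 2 1 + t *\<^sub>R (axis 1 1 + \<tau> *\<^sub>R axis 2 1) \<in> sector p c d" (is "?x \<in> _")
      define y2 where "y2 = u + t * \<tau>"
      have y: "(?x - p) $ 1 = t" "(?x - p) $ 2 = y2" by (simp_all add: axis_def y2_def)
      have cd: "c = - d" using c d False by auto
      have sec: "\<bar>t\<bar> \<le> d * y2"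
      proof -
        have "0 \<le> - d * (t - y2)" "0 \<le> d * (t + y2)"
          using x unfolding cd sector_def mem_Collect_eq Int_iff y by blast+
        with d show ?thesis by (elim disjE) auto
      qed
      have "hess (axis 1 1 + \<tau> *\<^sub>R axis 2 1) ?x = \<phi>11 ?x + 2 * \<tau> * \<phi>12 ?x + \<phi>22 ?x"
        using \<tau> by (auto simp: axis_def)
      moreover have "0 \<le> s * \<phi>11 p" by (simp add: s_def)
      ultimately show "\<bar>u\<bar> / 2 \<le> s * hess (axis 1 1 + \<tau> *\<^sub>R axis 2 1) ?x"
        using oblique_hess_bound[OF s d _ approx[OF x, unfolded y] sec, folded \<tau>_def, OF _ y2_def] by (simp only:)
    qed (use s in auto)
  qed
qed

text \<open>The four sectors cover the ball and overlap only on two lines through \<open>p\<close>,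
  which are null sets. Four equal bounds turn the constant 30 into 120.\<close>

lemma oscillatory_integral_bound:
  fixes a a1 a2 :: "real^2 \<Rightarrow> complex"
  assumes l: "l \<noteq> 0"
    and a: "\<And>x. (a has_derivative (\<lambda>h. h $ 1 *\<^sub>R a1 x + h $ 2 *\<^sub>R a2 x)) (at x)"
    and N: "\<And>x. x \<in> cball 0 (R / 2) \<Longrightarrow> norm (a x) \<le> N \<and> norm (a1 x) \<le> N \<and> norm (a2 x) \<le> N"
  shows "norm (LINT x:cball 0 (R / 2)|lborel. exp (\<i> * of_real (l * \<phi> x)) * a x)
      \<le> 120 * sqrt 2 * (LINT u|lborel. indicator {-2..2} u / sqrt \<bar>u\<bar>) * N / sqrt \<bar>l\<bar>"
proof -
  obtain p where p: "p \<in> cball 0 (R / 2)" "\<phi>12 p = 0" "\<phi>22 p = 0" by (rule degenerate_point)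
  define f where "f = (\<lambda>x. exp (\<i> * of_real (l * \<phi> x)) * a x)"
  define B where "B = 30 * sqrt 2 * (LINT u|lborel. indicator {-2..2} u / sqrt \<bar>u\<bar>) * N / sqrt \<bar>l\<bar>"
  define I where "I = (\<lambda>c d. LINT x|lborel. indicator (sector p c d) x *\<^sub>R f x)"
  have sub: "sector p c d \<subseteq> cball 0 (R / 2)" for c d unfolding sector_def by blast
  have I: "norm (I c d) \<le> B" if cd: "c = 1 \<or> c = -1" "d = 1 \<or> d = -1" for c d
  proof (rule sector_hess[OF p cd])
    fix s v w assume "s = 1 \<or> s = -1" "line_frame v w"
      "\<And>u t. p + u *\<^sub>R w + t *\<^sub>R v \<in> sector p c d \<Longrightarrow> \<bar>u\<bar> / 2 \<le> s * hess v (p + u *\<^sub>R w + t *\<^sub>R v)"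
    from sector_bound[OF l compact_sector convex_sector sub p(1) this a N] show ?thesis
      unfolding I_def B_def f_def by simp
  qed
  have "continuous_on UNIV a"
    using a has_derivative_continuous by (intro continuous_at_imp_continuous_on) blast
  then have cf: "continuous_on (cball 0 (R / 2)) f" unfolding f_def
    by (intro continuous_intros continuous_on_phase) (auto intro: continuous_on_subset)
  have int: "integrable lborel (\<lambda>x. indicator (sector p c d) x *\<^sub>R f x)" for c d
    by (rule borel_integrable_compact[OF compact_sector continuous_on_subset[OF cf sub]])
  have ne: "axis 1 1 - axis 2 1 \<noteq> (0 :: real^2)" "axis 1 1 + axis 2 1 \<noteq> (0 :: real^2)"
    by (simp_all add: vec_eq_iff forall_2 axis_def)
  have "(LINT x:cball 0 (R / 2)|lborel. f x) = (LINT x|lborel. indicator (sector p 1 1) x *\<^sub>R f x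
      + indicator (sector p 1 (-1)) x *\<^sub>R f x + indicator (sector p (-1) 1) x *\<^sub>R f x + indicator (sector p (-1) (-1)) x *\<^sub>R f x)"
    unfolding set_lebesgue_integral_def
  proof (rule integral_cong_AE)
    show "AE x in lborel. indicator (cball 0 (R / 2)) x *\<^sub>R f x = indicator (sector p 1 1) x *\<^sub>R f x
      + indicator (sector p 1 (-1)) x *\<^sub>R f x + indicator (sector p (-1) 1) x *\<^sub>R f x + indicator (sector p (-1) (-1)) x *\<^sub>R f x"
      using AE_lborel_hyperplane[OF ne(1), of "p $ 1 - p $ 2"] AE_lborel_hyperplane[OF ne(2), of "p $ 1 + p $ 2"]
    proof eventually_elim
      case (elim x)
      then have "x $ 1 - x $ 2 \<noteq> p $ 1 - p $ 2" "x $ 1 + x $ 2 \<noteq> p $ 1 + p $ 2"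
        by (simp_all add: inner_diff_left inner_add_left inner_axis')
      then show ?case unfolding sector_def indicator_def by auto
    qed
    show "(\<lambda>x. indicator (cball 0 (R / 2)) x *\<^sub>R f x) \<in> borel_measurable lborel"
      using borel_integrable_compact[OF compact_cball cf] by simp
    show "(\<lambda>x. indicator (sector p 1 1) x *\<^sub>R f x
      + indicator (sector p 1 (-1)) x *\<^sub>R f x + indicator (sector p (-1) 1) x *\<^sub>R f x + indicator (sector p (-1) (-1)) x *\<^sub>R f x)
      \<in> borel_measurable lborel"
      by (intro borel_measurable_add borel_measurable_integrable int)
  qed
  also have "\<dots> = I 1 1 + I 1 (-1) + I (-1) 1 + I (-1) (-1)"
    unfolding I_def using int by simp
  also have "norm \<dots> \<le> B + B + B + B"
    by (intro norm_triangle_mono I) auto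
  finally show ?thesis unfolding f_def B_def by (simp add: mult_ac)
qed

end

section \<open>Partial derivatives and Frechet derivatives\<close>

lemma C_open_le: "C_open n V f \<Longrightarrow> m \<le> n \<Longrightarrow> C_open m V f"
proof (induction m arbitrary: n f)
  case 0
  then show ?case by (cases n) auto
next
  case (Suc m)
  then obtain k where "n = Suc k" "m \<le> k" by (cases n) auto
  with Suc show ?case by auto
qed

lemma C_open_D: "C_open N V f \<Longrightarrow> fst \<alpha> + snd \<alpha> \<le> N \<Longrightarrow> C_open (N - (fst \<alpha> + snd \<alpha>)) V (D \<alpha> f)"
proof -
  have step: "C_open N V f \<Longrightarrow> k \<le> N \<Longrightarrow> C_open (N - k) V ((partial_deriv i ^^ k) f)" for N k i and f :: "real^2 \<Rightarrow> 'a"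
  proof (induction k)
    case (Suc k)
    then have "C_open (Suc (N - Suc k)) V ((partial_deriv i ^^ k) f)"
      by (simp add: Suc_diff_Suc)
    then show ?case by auto
  qed simp
  assume "C_open N V f" "fst \<alpha> + snd \<alpha> \<le> N"
  then show ?thesis
    unfolding D_def using step[OF step[of N f "snd \<alpha>" 2], of "fst \<alpha>" 1] by (simp add: add.commute)
qed

lemma partial_deriv_along_line:
  assumes "has_partial_deriv_at i f (x + s *\<^sub>R axis i 1)"
  shows "((\<lambda>t. f (x + t *\<^sub>R axis i 1)) has_vector_derivative partial_deriv i f (x + s *\<^sub>R axis i 1)) (at s)"
proof -
  have "((\<lambda>t. f ((x + s *\<^sub>R axis i 1) + t *\<^sub>R axis i 1)) has_vector_derivative partial_deriv i f (x + s *\<^sub>R axis i 1)) (at 0)"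
    using assms unfolding has_partial_deriv_at_def partial_deriv_def by (simp add: vector_derivative_works)
  moreover have "((\<lambda>t. t - s) has_vector_derivative 1) (at s)"
    by (auto intro!: derivative_eq_intros)
  ultimately have "((\<lambda>t. f ((x + s *\<^sub>R axis i 1) + t *\<^sub>R axis i 1)) \<circ> (\<lambda>t. t - s) has_vector_derivative
      1 *\<^sub>R partial_deriv i f (x + s *\<^sub>R axis i 1)) (at s)"
    by (intro vector_diff_chain_at) simp_all
  then show ?thesis by (simp add: o_def algebra_simps)
qed

lemma partial_deriv_along_line_real:
  fixes f :: "real^2 \<Rightarrow> real"
  assumes "has_partial_deriv_at i f (x + s *\<^sub>R axis i 1)"
  shows "((\<lambda>t. f (x + t *\<^sub>R axis i 1)) has_real_derivative partial_deriv i f (x + s *\<^sub>R axis i 1)) (at s)"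
  using partial_deriv_along_line[OF assms] by (simp add: has_real_derivative_iff_has_vector_derivative)

lemma axis_decomposition: "(h::real^2) = (h $ 1) *\<^sub>R axis 1 1 + (h $ 2) *\<^sub>R axis 2 1"
  by (simp add: vec_eq_iff forall_2 axis_def)

text \<open>Mean value inequality for the function on the line minus its linear part
  \<open>t *\<^sub>R c\<close>; the symmetric parameter interval treats both signs of
  \<open>s\<close> at once.\<close>

lemma partial_deriv_segment_bound:
  fixes f :: "real^2 \<Rightarrow> 'b::real_normed_vector"
  assumes "\<And>t. \<bar>t\<bar> \<le> \<bar>s\<bar> \<Longrightarrow> has_partial_deriv_at i f (z + t *\<^sub>R axis i 1)"
    and "\<And>t. \<bar>t\<bar> \<le> \<bar>s\<bar> \<Longrightarrow> norm (partial_deriv i f (z + t *\<^sub>R axis i 1) - c) \<le> e"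
  shows "norm (f (z + s *\<^sub>R axis i 1) - f z - s *\<^sub>R c) \<le> e * \<bar>s\<bar>"
proof -
  let ?S = "{t. \<bar>t\<bar> \<le> \<bar>s\<bar>}"
  let ?u = "\<lambda>t. f (z + t *\<^sub>R axis i 1) - t *\<^sub>R c"
  have "e \<ge> 0" using order_trans[OF norm_ge_zero assms(2)[of 0]] by simp
  have S: "?S = {-\<bar>s\<bar>..\<bar>s\<bar>}" by auto
  have "norm (?u s - ?u 0) \<le> e * norm (s - 0)"
  proof (rule differentiable_bound[of ?S])
    show "convex ?S" unfolding S by simp
    fix t assume t: "t \<in> ?S"
    have "(?u has_vector_derivative (partial_deriv i f (z + t *\<^sub>R axis i 1) - c)) (at t)"
      using partial_deriv_along_line[OF assms(1)] t
      by (auto intro!: derivative_eq_intros has_vector_derivative_diff)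
    then show "(?u has_derivative (\<lambda>r. r *\<^sub>R (partial_deriv i f (z + t *\<^sub>R axis i 1) - c))) (at t within ?S)"
      unfolding has_vector_derivative_def by (rule has_derivative_at_withinI)
    show "onorm (\<lambda>r::real. r *\<^sub>R (partial_deriv i f (z + t *\<^sub>R axis i 1) - c)) \<le> e"
    proof (rule onorm_bound[OF \<open>e \<ge> 0\<close>])
      fix r :: real
      show "norm (r *\<^sub>R (partial_deriv i f (z + t *\<^sub>R axis i 1) - c)) \<le> e * norm r"
        using mult_left_mono[OF assms(2)[of t], of "\<bar>r\<bar>"] t by (simp add: mult.commute)
    qed
  qed auto
  then show ?thesis by (simp add: algebra_simps)
qed

text \<open>The increment is split along the path from \<open>x\<close> to the corner
  \<open>z\<close> and on to \<open>y\<close>, parallel to the axes. Continuity of the partial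
  derivatives lets each leg be compared with the value at \<open>x\<close>.\<close>

lemma C_open_has_derivative:
  fixes f :: "real^2 \<Rightarrow> 'b::real_normed_vector"
  assumes "open V" "C_open 1 V f" "x \<in> V"
  shows "(f has_derivative (\<lambda>h. h $ 1 *\<^sub>R partial_deriv 1 f x + h $ 2 *\<^sub>R partial_deriv 2 f x)) (at x)"
proof -
  have part: "has_partial_deriv_at i f y" if "y \<in> V" for y i using assms(2) that by auto
  have cont: "continuous_on V (partial_deriv i f)" for i using assms(2) by simp
  have lin: "bounded_linear (\<lambda>h::real^2. h $ 1 *\<^sub>R partial_deriv 1 f x + h $ 2 *\<^sub>R partial_deriv 2 f x)"
    by (intro bounded_linear_add bounded_linear_compose[OF bounded_linear_scaleR_left] bounded_linear_vec_nth)
  have "\<exists>d>0. \<forall>y. norm (y - x) < d \<longrightarrow> norm (f y - f x - ((y - x) $ 1 *\<^sub>R partial_deriv 1 f x + (y - x) $ 2 *\<^sub>R partial_deriv 2 f x)) \<le> e * norm (y - x)"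
    if "e > 0" for e
  proof -
    have "\<forall>i. \<exists>d>0. \<forall>y. dist y x < d \<longrightarrow> y \<in> V \<and> norm (partial_deriv i f y - partial_deriv i f x) \<le> e / 2"
    proof
      fix i
      have "continuous (at x) (partial_deriv i f)"
        using cont[of i] assms(1,3) by (simp add: continuous_on_eq_continuous_at)
      then obtain d where d: "d > 0" "\<And>y. dist y x < d \<Longrightarrow> dist (partial_deriv i f y) (partial_deriv i f x) < e / 2"
        unfolding continuous_at_eps_delta using half_gt_zero[OF \<open>e > 0\<close>] by blast
      obtain d' where d': "d' > 0" "ball x d' \<subseteq> V" using assms(1,3) openE by blast
      show "\<exists>d>0. \<forall>y. dist y x < d \<longrightarrow> y \<in> V \<and> norm (partial_deriv i f y - partial_deriv i f x) \<le> e / 2"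
      proof (intro exI[of _ "min d d'"] conjI allI impI)
        fix y assume "dist y x < min d d'"
        then show "y \<in> V" using d' by (auto simp: dist_commute)
        show "norm (partial_deriv i f y - partial_deriv i f x) \<le> e / 2"
          using d(2)[of y] \<open>dist y x < min d d'\<close> by (simp add: dist_norm)
      qed (use d d' in simp)
    qed
    then obtain \<delta> where \<delta>: "\<And>i. \<delta> i > 0"
      "\<And>i y. dist y x < \<delta> i \<Longrightarrow> y \<in> V \<and> norm (partial_deriv i f y - partial_deriv i f x) \<le> e / 2"
      by metis
    \<comment> \<open>The path may leave the ball of radius \<open>d\<close>, but its points stay
      within |h_1| + |h_2| < 2 d of \<open>x\<close>; hence the division by 2.\<close>
    define d where "d = min (\<delta> 1) (\<delta> 2) / 2"
    have near: "y \<in> V" "norm (partial_deriv i f y - partial_deriv i f x) \<le> e / 2" if "dist y x < 2 * d" for y i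
      using \<delta>(2)[of y i] that exhaust_2[of i] by (auto simp: d_def)
    show ?thesis
    proof (intro exI[of _ d] conjI allI impI)
      show "d > 0" using \<delta>(1) by (simp add: d_def)
      fix y assume y: "norm (y - x) < d"
      define h where "h = y - x"
      define z where "z = x + (h $ 1) *\<^sub>R axis 1 1"
      have hi: "\<bar>h $ i\<bar> \<le> norm h" "\<bar>h $ i\<bar> < d" for i
        using component_le_norm_cart[of h i] y by (auto simp: h_def)
      have yz: "y = z + (h $ 2) *\<^sub>R axis 2 1"
        using axis_decomposition[of h] unfolding z_def h_def by (metis add.assoc add.commute diff_add_cancel)
      have close1: "dist (x + t *\<^sub>R axis 1 1) x < 2 * d" if "\<bar>t\<bar> \<le> \<bar>h $ 1\<bar>" for t
        using that hi(2)[of 1] by (simp add: dist_norm)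
      have close2: "dist (z + t *\<^sub>R axis 2 1) x < 2 * d" if "\<bar>t\<bar> \<le> \<bar>h $ 2\<bar>" for t
      proof -
        have "norm ((h $ 1) *\<^sub>R axis 1 1 + t *\<^sub>R axis 2 1 :: real^2) \<le> \<bar>h $ 1\<bar> + \<bar>t\<bar>"
          by (rule order_trans[OF norm_triangle_ineq]) simp
        moreover have eq: "z + t *\<^sub>R axis 2 1 - x = (h $ 1) *\<^sub>R axis 1 1 + t *\<^sub>R axis 2 1" by (simp add: z_def)
        ultimately show ?thesis using that hi(2)[of 1] hi(2)[of 2] unfolding dist_norm eq by linarith
      qed
      have b1: "norm (f z - f x - (h $ 1) *\<^sub>R partial_deriv 1 f x) \<le> e / 2 * \<bar>h $ 1\<bar>"
        unfolding z_def by (rule partial_deriv_segment_bound) (use near close1 part in blast)+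
      have b2: "norm (f y - f z - (h $ 2) *\<^sub>R partial_deriv 2 f x) \<le> e / 2 * \<bar>h $ 2\<bar>"
        unfolding yz by (rule partial_deriv_segment_bound) (use near close2 part in blast)+
      have "f y - f x - (h $ 1 *\<^sub>R partial_deriv 1 f x + h $ 2 *\<^sub>R partial_deriv 2 f x)
          = (f z - f x - (h $ 1) *\<^sub>R partial_deriv 1 f x) + (f y - f z - (h $ 2) *\<^sub>R partial_deriv 2 f x)"
        by simp
      also have "norm \<dots> \<le> e / 2 * \<bar>h $ 1\<bar> + e / 2 * \<bar>h $ 2\<bar>"
        using norm_triangle_mono[OF b1 b2] .
      also have "\<dots> \<le> e / 2 * norm h + e / 2 * norm h"
        using hi(1) \<open>e > 0\<close> by (intro add_mono mult_left_mono) auto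
      finally show "norm (f y - f x - ((y - x) $ 1 *\<^sub>R partial_deriv 1 f x + (y - x) $ 2 *\<^sub>R partial_deriv 2 f x)) \<le> e * norm (y - x)"
        unfolding h_def by simp
    qed
  qed
  with lin show ?thesis unfolding has_derivative_at_alt by blast
qed

section \<open>Symmetry of second partial derivatives\<close>

lemma second_difference_mean_value:
  fixes f :: "real^2 \<Rightarrow> real"
  assumes "ball x d \<subseteq> V" "C_open 2 V f" "0 < h" "2 * h < d"
  shows "\<exists>y\<in>ball x d. f (x + h *\<^sub>R axis i 1 + h *\<^sub>R axis j 1) - f (x + h *\<^sub>R axis i 1)
      - f (x + h *\<^sub>R axis j 1) + f x = h\<^sup>2 * partial_deriv j (partial_deriv i f) y"
proof -
  have p: "has_partial_deriv_at k f y" "has_partial_deriv_at k (partial_deriv l f) y" if "y \<in> ball x d" for k l y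
    using assms(1,2) that by (auto simp: numeral_2_eq_2)
  have near: "x + s *\<^sub>R axis k 1 + t *\<^sub>R axis l 1 \<in> ball x d" if "0 \<le> s" "s \<le> h" "0 \<le> t" "t \<le> h" for s t k l
  proof -
    have "norm (s *\<^sub>R axis k 1 + t *\<^sub>R axis l 1 :: real^2) \<le> \<bar>s\<bar> + \<bar>t\<bar>"
      by (rule order_trans[OF norm_triangle_ineq]) simp
    moreover have "x - (x + s *\<^sub>R axis k 1 + t *\<^sub>R axis l 1) = - (s *\<^sub>R axis k 1 + t *\<^sub>R axis l 1)" by simp
    ultimately show ?thesis using that assms(4) unfolding mem_ball dist_norm by (metis (no_types) norm_minus_cancel abs_of_nonneg add_mono le_less_trans mult_2 order_trans)
  qed
  have near1: "x + s *\<^sub>R axis k 1 \<in> ball x d" if "0 \<le> s" "s \<le> h" for s k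
    using near[of s 0] that assms(3) by simp
  have "\<exists>s. 0 < s \<and> s < h \<and> (f (x + h *\<^sub>R axis j 1 + h *\<^sub>R axis i 1) - f (x + h *\<^sub>R axis i 1))
      - (f (x + h *\<^sub>R axis j 1 + 0 *\<^sub>R axis i 1) - f (x + 0 *\<^sub>R axis i 1))
      = (h - 0) * (partial_deriv i f (x + h *\<^sub>R axis j 1 + s *\<^sub>R axis i 1) - partial_deriv i f (x + s *\<^sub>R axis i 1))"
    using assms(3)
    by (intro MVT2[of 0 h "\<lambda>s. f (x + h *\<^sub>R axis j 1 + s *\<^sub>R axis i 1) - f (x + s *\<^sub>R axis i 1)"])
       (auto intro!: DERIV_diff partial_deriv_along_line_real p near near1)
  then obtain s where s: "0 < s" "s < h"
    and 1: "(f (x + h *\<^sub>R axis j 1 + h *\<^sub>R axis i 1) - f (x + h *\<^sub>R axis i 1)) - (f (x + h *\<^sub>R axis j 1) - f x)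
      = h * (partial_deriv i f (x + h *\<^sub>R axis j 1 + s *\<^sub>R axis i 1) - partial_deriv i f (x + s *\<^sub>R axis i 1))"
    by auto
  have "\<exists>t. 0 < t \<and> t < h \<and> partial_deriv i f (x + s *\<^sub>R axis i 1 + h *\<^sub>R axis j 1) - partial_deriv i f (x + s *\<^sub>R axis i 1 + 0 *\<^sub>R axis j 1)
      = (h - 0) * partial_deriv j (partial_deriv i f) (x + s *\<^sub>R axis i 1 + t *\<^sub>R axis j 1)"
    using assms(3) s
    by (intro MVT2[of 0 h "\<lambda>t. partial_deriv i f (x + s *\<^sub>R axis i 1 + t *\<^sub>R axis j 1)"])
       (auto intro!: partial_deriv_along_line_real p near near1)
  then obtain t where t: "0 < t" "t < h"
    and 2: "partial_deriv i f (x + s *\<^sub>R axis i 1 + h *\<^sub>R axis j 1) - partial_deriv i f (x + s *\<^sub>R axis i 1)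
      = h * partial_deriv j (partial_deriv i f) (x + s *\<^sub>R axis i 1 + t *\<^sub>R axis j 1)"
    by auto
  have comm: "x + a *\<^sub>R axis i 1 + b *\<^sub>R axis j 1 = x + b *\<^sub>R axis j 1 + a *\<^sub>R axis i 1" for a b by simp
  show ?thesis
    using 1 2 s t near[of s t i j] unfolding comm[of s h] comm[of h h] power2_eq_square mult.assoc
    by (intro bexI[of _ "x + s *\<^sub>R axis i 1 + t *\<^sub>R axis j 1"]) (simp_all add: algebra_simps)
qed

text \<open>The second difference is symmetric in the two directions, so the two iterated
  derivatives agree at some pair of points near \<open>x\<close>. If they differed at
  \<open>x\<close>, continuity with tolerance half the gap would exclude this.\<close>

lemma partial_deriv_commute:
  fixes f :: "real^2 \<Rightarrow> real"
  assumes "open V" "C_open 2 V f" "x \<in> V"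
  shows "partial_deriv i (partial_deriv j f) x = partial_deriv j (partial_deriv i f) x"
proof (rule ccontr)
  let ?p = "partial_deriv i (partial_deriv j f)" and ?q = "partial_deriv j (partial_deriv i f)"
  assume ne: "?p x \<noteq> ?q x"
  define e where "e = \<bar>?p x - ?q x\<bar> / 2"
  have "e > 0" using ne by (simp add: e_def)
  have "continuous (at x) ?p" "continuous (at x) ?q"
    using assms by (auto simp: numeral_2_eq_2 continuous_on_eq_continuous_at)
  then obtain d1 d2 where d: "d1 > 0" "\<And>y. dist y x < d1 \<Longrightarrow> dist (?p y) (?p x) < e"
      "d2 > 0" "\<And>y. dist y x < d2 \<Longrightarrow> dist (?q y) (?q x) < e"
    unfolding continuous_at_eps_delta using \<open>e > 0\<close> by metis
  obtain d3 where d3: "d3 > 0" "ball x d3 \<subseteq> V" using assms(1,3) openE by blast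
  define d where "d = min d1 (min d2 d3)"
  have d0: "d > 0" "ball x d \<subseteq> V" using d d3 by (auto simp: d_def)
  \<comment> \<open>The step d/3 is small enough for the requirement
    \<open>2 * h < d\<close>.\<close>
  obtain y where y: "y \<in> ball x d" "f (x + (d/3) *\<^sub>R axis i 1 + (d/3) *\<^sub>R axis j 1) - f (x + (d/3) *\<^sub>R axis i 1)
      - f (x + (d/3) *\<^sub>R axis j 1) + f x = (d/3)\<^sup>2 * ?q y"
    using second_difference_mean_value[OF d0(2) assms(2), of "d/3" i j] d0(1) by auto
  obtain z where z: "z \<in> ball x d" "f (x + (d/3) *\<^sub>R axis j 1 + (d/3) *\<^sub>R axis i 1) - f (x + (d/3) *\<^sub>R axis j 1)
      - f (x + (d/3) *\<^sub>R axis i 1) + f x = (d/3)\<^sup>2 * ?p z"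
    using second_difference_mean_value[OF d0(2) assms(2), of "d/3" j i] d0(1) by auto
  have "(d/3)\<^sup>2 * ?q y = (d/3)\<^sup>2 * ?p z" using y(2) z(2) by (simp add: algebra_simps)
  then have "?q y = ?p z" using d0(1) by simp
  moreover have "dist (?p z) (?p x) < e" "dist (?q y) (?q x) < e"
    using d(2)[of z] d(4)[of y] y(1) z(1) by (auto simp: d_def dist_commute)
  ultimately show False unfolding e_def dist_real_def by (auto simp: abs_if split: if_splits)
qed

lemma partial_deriv_cong:
  assumes "open V" "x \<in> V" "\<And>y. y \<in> V \<Longrightarrow> f y = g y"
  shows "partial_deriv i f x = partial_deriv i g x"
proof -
  have "((\<lambda>t. x + t *\<^sub>R axis i 1) \<longlongrightarrow> x + 0 *\<^sub>R axis i 1) (nhds (0::real))"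
    by (intro tendsto_intros filterlim_ident)
  then have "\<forall>\<^sub>F t in nhds (0::real). x + t *\<^sub>R axis i 1 \<in> V"
    using assms(1,2) by (auto simp: tendsto_def)
  then have "\<forall>\<^sub>F t in nhds (0::real). f (x + t *\<^sub>R axis i 1) = g (x + t *\<^sub>R axis i 1)"
    by eventually_elim (use assms(3) in auto)
  then show ?thesis unfolding partial_deriv_def by (intro vector_derivative_cong_eq) (auto simp: eventually_nhds)
qed

text \<open>\<open>D\<close> applies the second-variable derivatives first, so each further
  derivative in the second variable has to be moved inwards past those in the first.\<close>

lemma C_open_3_derivatives:
  fixes h :: "real^2 \<Rightarrow> real"
  assumes V: "open V" and h: "C_open 3 V h" and x: "x \<in> V"
  shows "(h has_derivative (\<lambda>v. v $ 1 * D (1,0) h x + v $ 2 * D (0,1) h x)) (at x)"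
    "(D (1,0) h has_derivative (\<lambda>v. v $ 1 * D (2,0) h x + v $ 2 * D (1,1) h x)) (at x)"
    "(D (0,1) h has_derivative (\<lambda>v. v $ 1 * D (1,1) h x + v $ 2 * D (0,2) h x)) (at x)"
    "(D (2,0) h has_derivative (\<lambda>v. v $ 1 * D (3,0) h x + v $ 2 * D (2,1) h x)) (at x)"
    "(D (1,1) h has_derivative (\<lambda>v. v $ 1 * D (2,1) h x + v $ 2 * D (1,2) h x)) (at x)"
    "(D (0,2) h has_derivative (\<lambda>v. v $ 1 * D (1,2) h x + v $ 2 * D (0,3) h x)) (at x)"
proof -
  have C: "C_open 1 V (D \<alpha> h)" if "fst \<alpha> + snd \<alpha> \<le> 2" for \<alpha>
    by (rule C_open_le[OF C_open_D[OF h]]) (use that in auto)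
  have C2: "C_open 2 V h" "C_open 2 V (partial_deriv i h)" for i
    using h by (auto simp: eval_nat_numeral)
  have eqs: "partial_deriv 2 (partial_deriv 1 h) y = partial_deriv 1 (partial_deriv 2 h) y" if "y \<in> V" for y
    by (rule partial_deriv_commute[OF V C2(1) that])
  have "partial_deriv 2 (partial_deriv 1 (partial_deriv 1 h)) x = partial_deriv 1 (partial_deriv 2 (partial_deriv 1 h)) x"
    by (rule partial_deriv_commute[OF V C2(2) x])
  \<comment> \<open>This exchange happens under an outer derivative, so it uses the symmetry on all
    of \<open>V\<close> and not only at \<open>x\<close>.\<close>
  also have "\<dots> = partial_deriv 1 (partial_deriv 1 (partial_deriv 2 h)) x"
    by (rule partial_deriv_cong[OF V x eqs])
  finally have eq3: "partial_deriv 2 (partial_deriv 1 (partial_deriv 1 h)) x = partial_deriv 1 (partial_deriv 1 (partial_deriv 2 h)) x" .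
  have eq4: "partial_deriv 2 (partial_deriv 1 (partial_deriv 2 h)) x = partial_deriv 1 (partial_deriv 2 (partial_deriv 2 h)) x"
    by (rule partial_deriv_commute[OF V C2(2) x])
  note d = C_open_has_derivative[OF V C x]
  note s = D_def eval_nat_numeral eqs[OF x] eq3 eq4
  show "(h has_derivative (\<lambda>v. v $ 1 * D (1,0) h x + v $ 2 * D (0,1) h x)) (at x)"
    using d[of "(0,0)"] by (simp add: s)
  show "(D (1,0) h has_derivative (\<lambda>v. v $ 1 * D (2,0) h x + v $ 2 * D (1,1) h x)) (at x)"
    using d[of "(1,0)"] by (simp add: s)
  show "(D (0,1) h has_derivative (\<lambda>v. v $ 1 * D (1,1) h x + v $ 2 * D (0,2) h x)) (at x)"
    using d[of "(0,1)"] by (simp add: s)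
  show "(D (2,0) h has_derivative (\<lambda>v. v $ 1 * D (3,0) h x + v $ 2 * D (2,1) h x)) (at x)"
    using d[of "(2,0)"] by (simp add: s)
  show "(D (1,1) h has_derivative (\<lambda>v. v $ 1 * D (2,1) h x + v $ 2 * D (1,2) h x)) (at x)"
    using d[of "(1,1)"] by (simp add: s)
  show "(D (0,2) h has_derivative (\<lambda>v. v $ 1 * D (1,2) h x + v $ 2 * D (0,3) h x)) (at x)"
    using d[of "(0,2)"] by (simp add: s)
qed

section \<open>The uniform estimate\<close>

text \<open>A real supremum bounds its terms only over a set that is bounded above, which
  compactness of the closure provides. The family \<open>G\<close> is arbitrary so that the lemma
  serves both \<open>F\<close> on \<open>V\<close>, with the extensions from
  \<open>C_closure\<close>, and the amplitude on a ball, with its own derivatives.\<close>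

lemma norm_extension_le_C_norm:
  assumes "open V" "bounded V"
    and G: "\<And>\<alpha>. \<alpha> \<in> multi_indices N \<Longrightarrow> continuous_on (closure V) (G \<alpha>)"
      "\<And>\<alpha> x. \<alpha> \<in> multi_indices N \<Longrightarrow> x \<in> V \<Longrightarrow> G \<alpha> x = D \<alpha> f x"
    and x: "x \<in> closure V" and \<alpha>: "\<alpha> \<in> multi_indices N"
  shows "norm (G \<alpha> x) \<le> C_norm N V f"
proof -
  have eq: "D_closure V \<beta> f y = G \<beta> y" if "\<beta> \<in> multi_indices N" "y \<in> closure V" for \<beta> y
    by (rule D_closure_eq_extension[OF assms(1) G(1) _ that(2)]) (use G(2) that in auto)
  have "continuous_on (closure V) (\<lambda>y. \<Sum>\<beta>\<in>multi_indices N. norm (G \<beta> y))"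
    by (intro continuous_intros G)
  moreover have "compact (closure V)" using assms(2) by simp
  ultimately have "bounded ((\<lambda>y. \<Sum>\<beta>\<in>multi_indices N. norm (G \<beta> y)) ` closure V)"
    by (intro compact_imp_bounded compact_continuous_image)
  then have bdd: "bdd_above ((\<lambda>y. \<Sum>\<beta>\<in>multi_indices N. norm (G \<beta> y)) ` closure V)"
    by (rule bounded_imp_bdd_above)
  have "norm (G \<alpha> x) \<le> (\<Sum>\<beta>\<in>multi_indices N. norm (G \<beta> x))"
    using \<alpha> finite_multi_indices by (intro member_le_sum) auto
  also have "\<dots> \<le> (SUP y\<in>closure V. \<Sum>\<beta>\<in>multi_indices N. norm (G \<beta> y))"
    by (rule cSUP_upper[OF x bdd])
  also have "\<dots> = C_norm N V f"
    unfolding C_norm_def by (intro SUP_cong sum.cong refl) (simp add: eq)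
  finally show ?thesis .
qed

lemma norm_D_le_C_norm:
  assumes "open V" "bounded V" "C_closure N V f" "x \<in> V" "\<alpha> \<in> multi_indices N"
  shows "norm (D \<alpha> f x) \<le> C_norm N V f"
proof -
  obtain G where G: "\<And>\<alpha>. \<alpha> \<in> multi_indices N \<Longrightarrow> continuous_on (closure V) (G \<alpha>)"
      "\<And>\<alpha> x. \<alpha> \<in> multi_indices N \<Longrightarrow> x \<in> V \<Longrightarrow> G \<alpha> x = D \<alpha> f x"
    using assms(3) unfolding C_closure_def by metis
  have "x \<in> closure V" using assms(4) closure_subset by blast
  from norm_extension_le_C_norm[OF assms(1,2) G this assms(5)] G(2)[OF assms(5,4)]
  show ?thesis by simp
qed

section \<open>Perturbations of the cubic x_1 x_2^2\<close>

lemma Lipschitz_on_ball_of_partials: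
  fixes H P Q :: "real^2 \<Rightarrow> real"
  assumes d: "\<And>x. x \<in> ball 0 R \<Longrightarrow> (H has_derivative (\<lambda>v. v $ 1 * P x + v $ 2 * Q x)) (at x)"
    and b: "\<And>x. x \<in> ball 0 R \<Longrightarrow> \<bar>P x\<bar> \<le> \<eta>" "\<And>x. x \<in> ball 0 R \<Longrightarrow> \<bar>Q x\<bar> \<le> \<eta>"
    and xy: "x \<in> ball 0 R" "y \<in> ball 0 R"
  shows "\<bar>H x - H y\<bar> \<le> 2 * \<eta> * norm (x - y)"
proof -
  have \<eta>: "0 \<le> \<eta>" using b(1)[OF xy(1)] by linarith
  have "norm (H x - H y) \<le> 2 * \<eta> * norm (x - y)"
  proof (rule differentiable_bound[OF convex_ball _ _ xy])
    fix z assume z: "z \<in> ball (0 :: real^2) R"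
    show "(H has_derivative (\<lambda>v. v $ 1 * P z + v $ 2 * Q z)) (at z within ball 0 R)"
      by (rule has_derivative_at_withinI[OF d[OF z]])
    show "onorm (\<lambda>v :: real^2. v $ 1 * P z + v $ 2 * Q z) \<le> 2 * \<eta>"
    proof (rule onorm_bound)
      fix v :: "real^2"
      have "norm (v $ 1 * P z + v $ 2 * Q z) \<le> \<bar>v $ 1\<bar> * \<bar>P z\<bar> + \<bar>v $ 2\<bar> * \<bar>Q z\<bar>"
        by (rule order_trans[OF norm_triangle_ineq]) (simp add: abs_mult)
      also have "\<dots> \<le> norm v * \<eta> + norm v * \<eta>"
        by (intro add_mono mult_mono component_le_norm_cart b z) auto
      finally show "norm (v $ 1 * P z + v $ 2 * Q z) \<le> 2 * \<eta> * norm v" by (simp add: mult_ac)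
    qed (use \<eta> in simp)
  qed
  then show ?thesis by simp
qed

lemma second_derivatives_Lipschitz:
  fixes h :: "real^2 \<Rightarrow> real"
  assumes V: "open V" "ball 0 R \<subseteq> V" and h: "C_open 3 V h"
    and h3: "\<And>\<alpha> x. x \<in> ball 0 R \<Longrightarrow> \<alpha> \<in> multi_indices 3 \<Longrightarrow> \<bar>D \<alpha> h x\<bar> \<le> \<eta>"
    and \<alpha>: "fst \<alpha> + snd \<alpha> = 2" and xy: "x \<in> ball 0 R" "y \<in> ball 0 R"
  shows "\<bar>D \<alpha> h x - D \<alpha> h y\<bar> \<le> 2 * \<eta> * norm (x - y)"
proof -
  have d: "(D (2,0) h has_derivative (\<lambda>v. v $ 1 * D (3,0) h z + v $ 2 * D (2,1) h z)) (at z)"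
    "(D (1,1) h has_derivative (\<lambda>v. v $ 1 * D (2,1) h z + v $ 2 * D (1,2) h z)) (at z)"
    "(D (0,2) h has_derivative (\<lambda>v. v $ 1 * D (1,2) h z + v $ 2 * D (0,3) h z)) (at z)"
    if "z \<in> ball 0 R" for z
    using C_open_3_derivatives(4-6)[OF V(1) h, of z] that V(2) by auto
  have b: "\<bar>D (3,0) h z\<bar> \<le> \<eta>" "\<bar>D (2,1) h z\<bar> \<le> \<eta>" "\<bar>D (1,2) h z\<bar> \<le> \<eta>" "\<bar>D (0,3) h z\<bar> \<le> \<eta>"
    if "z \<in> ball 0 R" for z
    using h3[OF that] by (simp_all add: multi_indices_def)
  obtain i j where ij: "\<alpha> = (i, j)" "i + j = 2" using \<alpha> by (cases \<alpha>) auto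
  then consider "\<alpha> = (2,0)" | "\<alpha> = (1,1)" | "\<alpha> = (0,2)" by (cases i; cases "i - 1") auto
  then show ?thesis
  proof cases
    case 1
    show ?thesis unfolding 1 by (rule Lipschitz_on_ball_of_partials[OF d(1) b(1,2) xy])
  next
    case 2
    show ?thesis unfolding 2 by (rule Lipschitz_on_ball_of_partials[OF d(2) b(2,3) xy])
  next
    case 3
    show ?thesis unfolding 3 by (rule Lipschitz_on_ball_of_partials[OF d(3) b(3,4) xy])
  qed
qed

text \<open>Third derivatives bounded by 1/64 give Lipschitz constant 1/32 for the second
  derivatives of each of \<open>g\<close> and \<open>F\<close>, in total 1/16. The bound for
  \<open>F\<close> is proportional to \<open>R\<close> because its second derivatives at 0 displace
  the degenerate point, which must stay in the ball; those of \<open>g\<close> in question vanish at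
  0.\<close>

lemma near_D4_phase_perturbation:
  fixes f g F :: "real^2 \<Rightarrow> real"
  assumes V: "open V" "ball 0 R \<subseteq> V" and R: "0 < R" "R \<le> 1"
    and g: "C_open 3 V g" and F: "C_open 3 V F"
    and f: "\<And>x. x \<in> V \<Longrightarrow> f x = x $ 1 * (x $ 2)\<^sup>2 + g x"
    and g0: "D (1,1) g 0 = 0" "D (0,2) g 0 = 0"
    and g3: "\<And>\<alpha> x. x \<in> ball 0 R \<Longrightarrow> \<alpha> \<in> multi_indices 3 \<Longrightarrow> \<bar>D \<alpha> g x\<bar> \<le> 1 / 64"
    and F3: "\<And>\<alpha> x. x \<in> ball 0 R \<Longrightarrow> \<alpha> \<in> multi_indices 3 \<Longrightarrow> \<bar>D \<alpha> F x\<bar> \<le> R / 64"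
  shows "near_D4_phase (\<lambda>x. f x + F x)
    (\<lambda>x. (x $ 2)\<^sup>2 + (D (1,0) g x + D (1,0) F x)) (\<lambda>x. 2 * x $ 1 * x $ 2 + (D (0,1) g x + D (0,1) F x))
    (\<lambda>x. D (2,0) g x + D (2,0) F x) (\<lambda>x. 2 * x $ 2 + (D (1,1) g x + D (1,1) F x))
    (\<lambda>x. 2 * x $ 1 + (D (0,2) g x + D (0,2) F x)) R"
proof
  have nth: "((\<lambda>x :: real^2. x $ i) has_derivative (\<lambda>h. h $ i)) (at x)" for i x
    by (rule bounded_linear_imp_has_derivative[OF bounded_linear_vec_nth])
  note dg = C_open_3_derivatives[OF V(1) g] and dF = C_open_3_derivatives[OF V(1) F]
  have inV: "x \<in> V" if "x \<in> ball 0 R" for x using that V(2) by blast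
  show "((\<lambda>x. f x + F x) has_derivative
      (\<lambda>h. h $ 1 * ((x $ 2)\<^sup>2 + (D (1,0) g x + D (1,0) F x)) + h $ 2 * (2 * x $ 1 * x $ 2 + (D (0,1) g x + D (0,1) F x)))) (at x)"
    if x: "x \<in> ball 0 R" for x
  \<comment> \<open>The formula for \<open>f\<close> holds only on \<open>V\<close>, so the
    derivative is transferred from the explicit expression through the open set
    \<open>V\<close>.\<close>
  proof (rule has_derivative_transform_within_open[OF _ V(1) inV[OF x]])
    show "((\<lambda>x. x $ 1 * (x $ 2)\<^sup>2 + (g x + F x)) has_derivative
      (\<lambda>h. h $ 1 * ((x $ 2)\<^sup>2 + (D (1,0) g x + D (1,0) F x)) + h $ 2 * (2 * x $ 1 * x $ 2 + (D (0,1) g x + D (0,1) F x)))) (at x)"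
      by (rule has_derivative_eq_rhs, (rule derivative_intros nth dg(1) dF(1) inV x)+)
         (simp add: fun_eq_iff algebra_simps power2_eq_square)
  qed (simp add: f)
  show "((\<lambda>x. (x $ 2)\<^sup>2 + (D (1,0) g x + D (1,0) F x)) has_derivative
      (\<lambda>h. h $ 1 * (D (2,0) g x + D (2,0) F x) + h $ 2 * (2 * x $ 2 + (D (1,1) g x + D (1,1) F x)))) (at x)"
    if x: "x \<in> ball 0 R" for x
    by (rule has_derivative_eq_rhs, (rule derivative_intros nth dg(2) dF(2) inV x)+)
       (simp add: fun_eq_iff algebra_simps power2_eq_square)
  show "((\<lambda>x. 2 * x $ 1 * x $ 2 + (D (0,1) g x + D (0,1) F x)) has_derivative
      (\<lambda>h. h $ 1 * (2 * x $ 2 + (D (1,1) g x + D (1,1) F x)) + h $ 2 * (2 * x $ 1 + (D (0,2) g x + D (0,2) F x)))) (at x)"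
    if x: "x \<in> ball 0 R" for x
    by (rule has_derivative_eq_rhs, (rule derivative_intros nth dg(3) dF(3) inV x)+)
       (simp add: fun_eq_iff algebra_simps)
  have F3': "\<bar>D \<alpha> F x\<bar> \<le> 1 / 64" if "x \<in> ball 0 R" "\<alpha> \<in> multi_indices 3" for \<alpha> x
    using F3[OF that] R by linarith
  have lip: "\<bar>(D \<alpha> g x + D \<alpha> F x) - (D \<alpha> g y + D \<alpha> F y)\<bar> \<le> norm (x - y) / 8"
    if "fst \<alpha> + snd \<alpha> = 2" "x \<in> ball 0 R" "y \<in> ball 0 R" for \<alpha> x y
  proof -
    have "\<bar>D \<alpha> g x - D \<alpha> g y\<bar> \<le> 2 * (1 / 64) * norm (x - y)"
      by (rule second_derivatives_Lipschitz[OF V g g3 that])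
    moreover have "\<bar>D \<alpha> F x - D \<alpha> F y\<bar> \<le> 2 * (1 / 64) * norm (x - y)"
      by (rule second_derivatives_Lipschitz[OF V F F3' that])
    ultimately show ?thesis using norm_ge_zero[of "x - y"] by linarith
  qed
  fix x y :: "real^2" assume xy: "x \<in> ball 0 R" "y \<in> ball 0 R"
  show "\<bar>D (2,0) g x + D (2,0) F x - (D (2,0) g y + D (2,0) F y)\<bar> \<le> norm (x - y) / 8"
    by (rule lip[OF _ xy]) simp
  show "\<bar>2 * x $ 2 + (D (1,1) g x + D (1,1) F x) - (2 * y $ 2 + (D (1,1) g y + D (1,1) F y)) - 2 * (x - y) $ 2\<bar> \<le> norm (x - y) / 8"
    using lip[OF _ xy, of "(1,1)"] by (simp add: algebra_simps)
  show "\<bar>2 * x $ 1 + (D (0,2) g x + D (0,2) F x) - (2 * y $ 1 + (D (0,2) g y + D (0,2) F y)) - 2 * (x - y) $ 1\<bar> \<le> norm (x - y) / 8"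
    using lip[OF _ xy, of "(0,2)"] by (simp add: algebra_simps)
next
  have "(0 :: real^2) \<in> ball 0 R" using R by simp
  from F3[OF this, of "(1,1)"] F3[OF this, of "(0,2)"]
  show "\<bar>2 * (0 :: real^2) $ 2 + (D (1,1) g 0 + D (1,1) F 0)\<bar> \<le> R / 16"
    "\<bar>2 * (0 :: real^2) $ 1 + (D (0,2) g 0 + D (0,2) F 0)\<bar> \<le> R / 16"
    unfolding g0 using R by (simp_all add: multi_indices_def)
qed (use R in auto)

theorem mainTheorem1:
  fixes V :: "(real^2) set" and f g :: "real^2 \<Rightarrow> real"
  assumes "open V" and "bounded V" and "0 \<in> V"
    and "C_closure 8 V f" and "C_closure 8 V g"
    and "\<And>x. x \<in> closure V \<Longrightarrow> f x = x $ 1 * (x $ 2)\<^sup>2 + g x"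
    and "\<And>\<alpha>. \<alpha> \<in> multi_indices 3 \<Longrightarrow> D \<alpha> g 0 = 0"
  shows "\<exists>\<epsilon>>0. \<exists>C>0. \<exists>U. open U \<and> 0 \<in> U \<and> U \<subseteq> V \<and>
    (\<forall>(a :: real^2 \<Rightarrow> complex) \<in> C1_compact_support U. \<forall>F :: real^2 \<Rightarrow> real. \<forall>l::real.
      C_closure 8 V F \<longrightarrow> C_norm 8 V F < \<epsilon> \<longrightarrow> l \<noteq> 0 \<longrightarrow>
      norm (LINT x:U|lborel. exp (\<i> * complex_of_real (l * (f x + F x))) * a x)
        \<le> C * C_norm 1 U a / \<bar>l\<bar> powr (1/2))"
proof -
  have g8: "C_open 8 V g" using assms(5) by (simp add: C_closure_def)
  have "\<forall>\<^sub>F x in at 0. \<forall>\<alpha>\<in>multi_indices 3. \<bar>D \<alpha> g x\<bar> < 1 / 64"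
  proof (rule eventually_ball_finite[OF finite_multi_indices], rule ballI)
    fix \<alpha> assume \<alpha>: "\<alpha> \<in> multi_indices 3"
    have "C_open 0 V (D \<alpha> g)"
      by (rule C_open_le[OF C_open_D[OF g8]]) (use \<alpha> in \<open>auto simp: multi_indices_def\<close>)
    then have "isCont (D \<alpha> g) 0"
      using assms(1,3) by (simp add: continuous_on_eq_continuous_at)
    then have "(D \<alpha> g \<longlongrightarrow> 0) (at 0)" using assms(7)[OF \<alpha>] by (simp add: isCont_def)
    from tendstoD[OF this, of "1/64"] show "\<forall>\<^sub>F x in at 0. \<bar>D \<alpha> g x\<bar> < 1 / 64" by simp
  qed
  then obtain d where d: "d > 0" "\<And>x \<alpha>. x \<noteq> 0 \<Longrightarrow> dist x 0 < d \<Longrightarrow> \<alpha> \<in> multi_indices 3 \<Longrightarrow> \<bar>D \<alpha> g x\<bar> < 1 / 64"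
    unfolding eventually_at by blast
  obtain r where r: "r > 0" "ball 0 r \<subseteq> V" using assms(1,3) openE by blast
  \<comment> \<open>The bound 1 keeps chords short, \<open>d\<close> makes the derivatives of
    \<open>g\<close> small, and \<open>r\<close> keeps the ball inside \<open>V\<close>.
    \<open>R\<close> depends on \<open>g\<close> and \<open>V\<close> alone, which makes the final
    constants uniform in \<open>F\<close>.\<close>
  define R where "R = min 1 (min d r)"
  have R: "0 < R" "R \<le> 1" "ball 0 R \<subseteq> V" using d r by (auto simp: R_def)
  \<comment> \<open>The limit says nothing at the origin itself, where the vanishing of the
    derivatives of \<open>g\<close> is used.\<close>
  have g3: "\<bar>D \<alpha> g x\<bar> \<le> 1 / 64" if "x \<in> ball 0 R" "\<alpha> \<in> multi_indices 3" for x \<alpha>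
  proof (cases "x = 0")
    case True
    then show ?thesis using assms(7)[OF that(2)] by simp
  next
    case False
    then show ?thesis using d(2)[OF False _ that(2)] that(1) by (simp add: R_def)
  qed
  define J where "J = (LINT u|lborel. indicator {-2..2} u / sqrt \<bar>u\<bar> :: real)"
  have "J \<ge> 0" unfolding J_def by (intro integral_nonneg_AE) auto
  \<comment> \<open>Half the radius, so that the closure of \<open>U\<close> is the closed ball in
    which the degenerate point lies and on which the Hessian is controlled.\<close>
  define U where "U = ball (0 :: real^2) (R / 2)"
  have U: "open U" "bounded U" "0 \<in> U" "closure U = cball 0 (R / 2)" using R by (simp_all add: U_def)
  have "U \<subseteq> V" using R unfolding U_def by force
  have main: "norm (LINT x:U|lborel. exp (\<i> * complex_of_real (l * (f x + F x))) * a x)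
      \<le> (120 * sqrt 2 * J + 1) * C_norm 1 U a / \<bar>l\<bar> powr (1/2)"
    if a: "a \<in> C1_compact_support U" and F: "C_closure 8 V F" "C_norm 8 V F < R / 64" and l: "l \<noteq> 0"
    for a :: "real^2 \<Rightarrow> complex" and F :: "real^2 \<Rightarrow> real" and l :: real
  proof -
    have F3: "\<bar>D \<alpha> F x\<bar> \<le> R / 64" if "x \<in> ball 0 R" "\<alpha> \<in> multi_indices 3" for x \<alpha>
    proof -
      have "\<alpha> \<in> multi_indices 8" using that(2) by (simp add: multi_indices_def)
      from norm_D_le_C_norm[OF assms(1,2) F(1) _ this, of x] that(1) R(3) F(2) show ?thesis by auto
    qed
    interpret near_D4_phase "\<lambda>x. f x + F x"
      "\<lambda>x. (x $ 2)\<^sup>2 + (D (1,0) g x + D (1,0) F x)" "\<lambda>x. 2 * x $ 1 * x $ 2 + (D (0,1) g x + D (0,1) F x)"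
      "\<lambda>x. D (2,0) g x + D (2,0) F x" "\<lambda>x. 2 * x $ 2 + (D (1,1) g x + D (1,1) F x)"
      "\<lambda>x. 2 * x $ 1 + (D (0,2) g x + D (0,2) F x)" R
    proof (rule near_D4_phase_perturbation[OF assms(1) R(3,1,2) _ _ _ _ _ g3 F3])
      show "C_open 3 V g" "C_open 3 V F"
        using C_open_le[OF g8] C_open_le[of 8 V F 3] F(1) by (auto simp: C_closure_def)
      show "f x = x $ 1 * (x $ 2)\<^sup>2 + g x" if "x \<in> V" for x
        using assms(6) closure_subset that by blast
      show "D (1,1) g 0 = 0" "D (0,2) g 0 = 0" by (simp_all add: assms(7) multi_indices_def)
    qed
    have aC: "C_open 1 UNIV a" and supp: "a x \<noteq> 0 \<Longrightarrow> x \<in> U" for x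
      using a closure_subset[of "{x. a x \<noteq> 0}"] by (auto simp: C1_compact_support_def)
    have bound: "norm (D \<alpha> a x) \<le> C_norm 1 U a" if "\<alpha> \<in> multi_indices 1" "x \<in> cball 0 (R / 2)" for \<alpha> x
    proof (rule norm_extension_le_C_norm[OF U(1,2), of 1 "\<lambda>\<alpha>. D \<alpha> a"])
      fix \<beta> :: "nat \<times> nat" assume "\<beta> \<in> multi_indices 1"
      then have "C_open 0 UNIV (D \<beta> a)"
        by (intro C_open_le[OF C_open_D[OF aC]]) (auto simp: multi_indices_def)
      then show "continuous_on (closure U) (D \<beta> a)" by (auto intro: continuous_on_subset)
    qed (use that U(4) in auto)
    have N: "norm (a x) \<le> C_norm 1 U a \<and> norm (partial_deriv 1 a x) \<le> C_norm 1 U a \<and> norm (partial_deriv 2 a x) \<le> C_norm 1 U a"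
      if "x \<in> cball 0 (R / 2)" for x
      using bound[OF _ that, of "(0,0)"] bound[OF _ that, of "(1,0)"] bound[OF _ that, of "(0,1)"]
      by (simp add: multi_indices_def D_def)
    have "C_norm 1 U a \<ge> 0" using N[of 0] R order_trans[OF norm_ge_zero] by auto
    \<comment> \<open>The amplitude vanishes off \<open>U\<close>, so the integral may be taken over
      the closed ball, whose sectors are compact.\<close>
    have "(LINT x:U|lborel. exp (\<i> * complex_of_real (l * (f x + F x))) * a x)
        = (LINT x:cball 0 (R / 2)|lborel. exp (\<i> * complex_of_real (l * (f x + F x))) * a x)"
      unfolding set_lebesgue_integral_def
    proof (intro Bochner_Integration.integral_cong refl)
      fix x
      show "indicator U x *\<^sub>R (exp (\<i> * complex_of_real (l * (f x + F x))) * a x)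
          = indicator (cball 0 (R / 2)) x *\<^sub>R (exp (\<i> * complex_of_real (l * (f x + F x))) * a x)"
        using supp[of x] by (cases "a x = 0") (auto simp: U_def)
    qed
    also have "norm \<dots> \<le> 120 * sqrt 2 * J * C_norm 1 U a / sqrt \<bar>l\<bar>"
      unfolding J_def
      by (rule oscillatory_integral_bound[OF l C_open_has_derivative[OF open_UNIV aC UNIV_I] N])
    also have "\<dots> \<le> (120 * sqrt 2 * J + 1) * C_norm 1 U a / sqrt \<bar>l\<bar>"
      using \<open>C_norm 1 U a \<ge> 0\<close> by (intro divide_right_mono mult_right_mono) auto
    finally show ?thesis by (simp add: powr_half_sqrt)
  qed
  \<comment> \<open>R / 64 is the smallness of \<open>F\<close> that
    \<open>near_D4_phase_perturbation\<close> asks for. The summand 1 makes the constant positive on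
    the basis of \<open>J \<ge> 0\<close> alone.\<close>
  show ?thesis
    using main U(1,3) \<open>U \<subseteq> V\<close> R(1) \<open>J \<ge> 0\<close>
    by (intro exI[of _ "R / 64"] exI[of _ "120 * sqrt 2 * J + 1"] exI[of _ U] conjI ballI allI impI)
       (auto intro: add_nonneg_pos)
qed

end
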